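(* Let $\mathcal{R}$ be a von Neumann algebra and $f:\mathcal{Q}(\mathcal{R})\to\mathbb{R}$ a bounded continuous function. Define $r_f:\mathcal{P}_0(\mathcal{R})\to\mathbb{R}$ by $r_f(P):=\sup\{f(\mathfrak{B}) : \mathfrak{B}\in\mathcal{Q}_P(\mathcal{R})\}$. Then there exists $A\in\mathcal{R}_{sa}$ with $f=f_A$ on $\mathcal{Q}(\mathcal{R})$ if and only if $r_f$ is completely increasing, i.e. $r_f(\bigvee_{k\in K}P_k)=\sup_{k\in K}r_f(P_k)$ for every nonempty family $(P_k)_{k\in K}$ in $\mathcal{P}_0(\mathcal{R})$.
   Context: $\mathcal{P}(\mathcal{R})$ is the projection lattice of $\mathcal{R}$ and $\mathcal{P}_0(\mathcal{R})$ its set of nonzero projections. A quasipoint of $\mathcal{P}(\mathcal{R})$ is a maximal subset $\mathfrak{B}$ with $0\notin\mathfrak{B}$ such that for all $P,Q\in\mathfrak{B}$ there is $R\in\mathfrak{B}$ with $R\le P\wedge Q$. $\mathcal{Q}(\mathcal{R})$ is the set of quasipoints, topologized by the basis $\mathcal{Q}_P(\mathcal{R}):=\{\mathfrak{B}: P\in\mathfrak{B}\}$. For $A\in\mathcal{R}_{sa}$ with right-continuous spectral family $(E^A_\lambda)$, $f_A(\mathfrak{B}):=\inf\{\lambda : E^A_\lambda\in\mathfrak{B}\}$. *)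

theory Defs
  imports "HOL-Analysis.Analysis"
begin

class chilbert_space = banach +
  fixes cscale :: "complex \<Rightarrow> 'a \<Rightarrow> 'a"
    and cinner :: "'a \<Rightarrow> 'a \<Rightarrow> complex"
  assumes cscale_add_right: "cscale c (x + y) = cscale c x + cscale c y"
    and cscale_add_left: "cscale (c + d) x = cscale c x + cscale d x"
    and cscale_cscale: "cscale c (cscale d x) = cscale (c * d) x"
    and cscale_one: "cscale 1 x = x"
    and scaleR_cscale: "scaleR r x = cscale (complex_of_real r) x"
    and cinner_conj: "cinner x y = cnj (cinner y x)"
    and cinner_add_right: "cinner x (y + z) = cinner x y + cinner x z"
    and cinner_cscale_right: "cinner x (cscale c y) = c * cinner x y"
    and norm_cinner: "norm x = sqrt (Re (cinner x x))"

definition bounded_op :: "('a::chilbert_space \<Rightarrow> 'a) \<Rightarrow> bool" where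
  "bounded_op T \<longleftrightarrow> bounded_linear T \<and> (\<forall>c x. T (cscale c x) = cscale c (T x))"

definition adj :: "('a::chilbert_space \<Rightarrow> 'a) \<Rightarrow> ('a \<Rightarrow> 'a)" where
  "adj T = (SOME S. \<forall>x y. cinner (S x) y = cinner x (T y))"

definition commutant :: "('a::chilbert_space \<Rightarrow> 'a) set \<Rightarrow> ('a \<Rightarrow> 'a) set" where
  "commutant S = {T. bounded_op T \<and> (\<forall>U\<in>S. T \<circ> U = U \<circ> T)}"

definition von_neumann_algebra :: "('a::chilbert_space \<Rightarrow> 'a) set \<Rightarrow> bool" where
  "von_neumann_algebra R \<longleftrightarrow>
     R \<subseteq> {T. bounded_op T} \<and> id \<in> R \<and>
     (\<forall>S\<in>R. \<forall>T\<in>R. (\<lambda>x. S x + T x) \<in> R \<and> S \<circ> T \<in> R) \<and>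
     (\<forall>c. \<forall>T\<in>R. (\<lambda>x. cscale c (T x)) \<in> R) \<and>
     (\<forall>T\<in>R. adj T \<in> R) \<and>
     commutant (commutant R) = R"

definition self_adjoint_part :: "('a::chilbert_space \<Rightarrow> 'a) set \<Rightarrow> ('a \<Rightarrow> 'a) set" where
  "self_adjoint_part R = {A \<in> R. adj A = A}"

definition is_proj :: "('a::chilbert_space \<Rightarrow> 'a) \<Rightarrow> bool" where
  "is_proj P \<longleftrightarrow> bounded_op P \<and> P \<circ> P = P \<and> adj P = P"

definition projections :: "('a::chilbert_space \<Rightarrow> 'a) set \<Rightarrow> ('a \<Rightarrow> 'a) set" where
  "projections R = {P \<in> R. is_proj P}"

definition proj_le :: "('a \<Rightarrow> 'a) \<Rightarrow> ('a \<Rightarrow> 'a) \<Rightarrow> bool" where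
  "proj_le P Q \<longleftrightarrow> P \<circ> Q = P"

definition nonzero_projections :: "('a::chilbert_space \<Rightarrow> 'a) set \<Rightarrow> ('a \<Rightarrow> 'a) set" where
  "nonzero_projections R = projections R - {\<lambda>x. 0}"

definition proj_inf :: "('a::chilbert_space \<Rightarrow> 'a) set \<Rightarrow> ('a \<Rightarrow> 'a) \<Rightarrow> ('a \<Rightarrow> 'a) \<Rightarrow> ('a \<Rightarrow> 'a)" where
  "proj_inf R P Q = (THE Z. Z \<in> projections R \<and> proj_le Z P \<and> proj_le Z Q \<and>
      (\<forall>Z'\<in>projections R. proj_le Z' P \<and> proj_le Z' Q \<longrightarrow> proj_le Z' Z))"

definition proj_Sup :: "('a::chilbert_space \<Rightarrow> 'a) set \<Rightarrow> ('a \<Rightarrow> 'a) set \<Rightarrow> ('a \<Rightarrow> 'a)" where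
  "proj_Sup R S = (THE P. P \<in> projections R \<and> (\<forall>Q\<in>S. proj_le Q P) \<and>
      (\<forall>P'\<in>projections R. (\<forall>Q\<in>S. proj_le Q P') \<longrightarrow> proj_le P P'))"

definition filter_base :: "('a::chilbert_space \<Rightarrow> 'a) set \<Rightarrow> ('a \<Rightarrow> 'a) set \<Rightarrow> bool" where
  "filter_base R B \<longleftrightarrow> B \<subseteq> projections R \<and> (\<lambda>x. 0) \<notin> B \<and>
     (\<forall>P\<in>B. \<forall>Q\<in>B. \<exists>Z\<in>B. proj_le Z (proj_inf R P Q))"

definition quasipoints :: "('a::chilbert_space \<Rightarrow> 'a) set \<Rightarrow> ('a \<Rightarrow> 'a) set set" where
  "quasipoints R = {B. filter_base R B \<and> (\<forall>B'. filter_base R B' \<and> B \<subseteq> B' \<longrightarrow> B' = B)}"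

definition quasipoints_at :: "('a::chilbert_space \<Rightarrow> 'a) set \<Rightarrow> ('a \<Rightarrow> 'a) \<Rightarrow> ('a \<Rightarrow> 'a) set set" where
  "quasipoints_at R P = {B \<in> quasipoints R. P \<in> B}"

definition quasipoint_topology :: "('a::chilbert_space \<Rightarrow> 'a) set \<Rightarrow> ('a \<Rightarrow> 'a) set topology" where
  "quasipoint_topology R = topology_generated_by {quasipoints_at R P | P. P \<in> projections R}"

text \<open>Right-continuous spectral family (resolution of the identity) of a bounded
self-adjoint operator A: E is an increasing, strongly right-continuous family of
projections, vanishing below some a and equal to the identity from some b on, and
A is the operator-norm limit of the Riemann--Stieltjes sums of
\<open>\<integral>_[a,b] \<lambda> dE(\<lambda>)\<close>.\<close>
definition spectral_family :: "('a::chilbert_space \<Rightarrow> 'a) \<Rightarrow> (real \<Rightarrow> 'a \<Rightarrow> 'a) \<Rightarrow> bool" where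
  "spectral_family A E \<longleftrightarrow>
     (\<forall>l. is_proj (E l)) \<and>
     (\<forall>l m. l \<le> m \<longrightarrow> proj_le (E l) (E m)) \<and>
     (\<forall>l x. ((\<lambda>m. E m x) \<longlongrightarrow> E l x) (at_right l)) \<and>
     (\<exists>a b. a < b \<and> (\<forall>l\<le>a. E l = (\<lambda>x. 0)) \<and> (\<forall>l\<ge>b. E l = id) \<and>
        (\<forall>\<epsilon>>0. \<exists>\<delta>>0. \<forall>(n::nat) (t::nat \<Rightarrow> real) (s::nat \<Rightarrow> real).
           n > 0 \<and> t 0 = a \<and> t n = b \<and>
           (\<forall>i<n. t i < t (Suc i) \<and> t (Suc i) - t i < \<delta> \<and> t i \<le> s i \<and> s i \<le> t (Suc i))
           \<longrightarrow> onorm (\<lambda>x. A x - (\<Sum>i<n. scaleR (s i) (E (t (Suc i)) x - E (t i) x))) < \<epsilon>))"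

definition spec_fam :: "('a::chilbert_space \<Rightarrow> 'a) \<Rightarrow> real \<Rightarrow> 'a \<Rightarrow> 'a" where
  "spec_fam A = (THE E. spectral_family A E)"

definition observable_fun :: "('a::chilbert_space \<Rightarrow> 'a) \<Rightarrow> ('a \<Rightarrow> 'a) set \<Rightarrow> real" where
  "observable_fun A B = Inf {l. spec_fam A l \<in> B}"

definition r_fun :: "('a::chilbert_space \<Rightarrow> 'a) set \<Rightarrow> (('a \<Rightarrow> 'a) set \<Rightarrow> real) \<Rightarrow> ('a \<Rightarrow> 'a) \<Rightarrow> real" where
  "r_fun R f P = Sup (f ` quasipoints_at R P)"

definition completely_increasing :: "('a::chilbert_space \<Rightarrow> 'a) set \<Rightarrow> (('a \<Rightarrow> 'a) \<Rightarrow> real) \<Rightarrow> bool" where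
  "completely_increasing R r \<longleftrightarrow>
     (\<forall>S. S \<noteq> {} \<and> S \<subseteq> nonzero_projections R \<longrightarrow> r (proj_Sup R S) = Sup (r ` S))"

end

theory Submission
  imports Defs
begin

text \<open>If \<open>A\<close> has spectral family \<open>E\<close>, then \<open>r P = Inf {l. P \<le> E l}\<close> for the function \<open>r\<close> of
  \<open>f\<^sub>A\<close>: when \<open>P\<close> is not below \<open>E l\<close>, a quasipoint through \<open>P - P \<and> E l\<close> avoids \<open>E l\<close>. This
  formula makes \<open>r\<close> completely increasing. Conversely, if \<open>r\<close> is completely increasing, the projections
  \<open>E l = Sup {P. r P \<le> l}\<close> satisfy \<open>P \<le> E l \<longleftrightarrow> r P \<le> l\<close>, hence form a right-continuous spectral
  family, and continuity of \<open>f\<close> identifies \<open>f\<close> with the observable function of \<open>\<integral> l dE l\<close>.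

  That an operator and its spectral family determine each other is expressed through cuts: a projection
  commuting with \<open>A\<close> such that \<open>A \<le> l\<close> on its range and \<open>A \<ge> l\<close> on its kernel. Cuts are built
  from square roots, and comparing growth rates of powers of \<open>A\<close> gives both uniqueness and membership in
  the bicommutant.\<close>

section \<open>The underlying real inner product\<close>

text \<open>A cut at \<open>l\<close> is not unique: eigenvectors of \<open>A\<close> for the value
  \<open>l\<close> may be placed on either side. Cuts are therefore compared only at levels
  \<open>l < m\<close>, and right-continuity removes the gap afterwards. For the same reason
  arbitrarily chosen cuts have to be replaced by their infima from the right before they form a
  spectral family. Since \<open>spec_fam\<close> is a definite description,
  \<open>observable_fun\<close> cannot be evaluated before both existence and uniqueness of spectral
  families are available. Order questions between projections are reduced to fixed vectors:
  \<open>P\<close> lies below \<open>Q\<close> when \<open>Q\<close> fixes the range of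
  \<open>P\<close>, an infimum fixes exactly the common fixed vectors, and a supremum is the infimum
  of the upper bounds. In the converse direction the danger is that the supremum of all
  \<open>P\<close> with \<open>r P \<le> l\<close> overshoots, that is, has a larger value of
  \<open>r\<close>; complete increase says precisely that it does not.\<close>

definition rin :: "'a::chilbert_space \<Rightarrow> 'a \<Rightarrow> real" where
  "rin x y = Re (cinner x y)"

lemma rin_commute: "rin x y = rin y x"
  unfolding rin_def by (subst cinner_conj) simp

lemma rin_add_right: "rin x (y + z) = rin x y + rin x z"
  by (simp add: rin_def cinner_add_right)

lemma rin_add_left: "rin (x + y) z = rin x z + rin y z"
  by (metis rin_commute rin_add_right)

lemma rin_scaleR_right: "rin x (scaleR r y) = r * rin x y"
  by (simp add: rin_def scaleR_cscale cinner_cscale_right)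

lemma rin_scaleR_left: "rin (scaleR r x) y = r * rin x y"
  by (metis rin_commute rin_scaleR_right)

lemma rin_self: "rin x x = (norm x)\<^sup>2"
proof -
  have "0 \<le> sqrt (Re (cinner x x))" by (metis norm_cinner norm_ge_zero)
  then show ?thesis by (simp add: rin_def norm_cinner)
qed

lemma norm_add_sq: "(norm (x + y))\<^sup>2 = (norm x)\<^sup>2 + 2 * rin x y + (norm (y::'a::chilbert_space))\<^sup>2"
  by (simp add: rin_self[symmetric] rin_add_left rin_add_right rin_commute[of y x])

lemma rin_minus_right: "rin x (- y) = - rin x y"
  using rin_scaleR_right[of x "-1" y] by simp

lemma rin_le_norm: "rin x y \<le> norm x * norm y"
proof -
  have "(norm (x + y))\<^sup>2 \<le> (norm x + norm y)\<^sup>2"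
    by (intro power_mono norm_triangle_ineq) simp
  then show ?thesis by (simp add: norm_add_sq power2_sum)
qed

lemma abs_rin_le_norm: "\<bar>rin x y\<bar> \<le> norm x * norm y"
  using rin_le_norm[of x y] rin_le_norm[of x "- y"] by (simp add: rin_minus_right)

interpretation rin: bounded_bilinear rin
proof
  show "\<exists>K. \<forall>a b::'a. norm (rin a b) \<le> norm a * norm b * K"
    by (intro exI[of _ 1]) (simp add: abs_rin_le_norm)
qed (simp_all add: rin_add_left rin_add_right rin_scaleR_left rin_scaleR_right)

declare rin.zero_left [simp] rin.zero_right [simp]

lemmas rin_simps = rin.add_left rin.add_right rin.diff_left rin.diff_right
  rin.scaleR_left rin.scaleR_right

lemma norm_diff_sq: "(norm (x - y))\<^sup>2 = (norm x)\<^sup>2 - 2 * rin x y + (norm (y::'a::chilbert_space))\<^sup>2"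
  by (simp add: rin_self[symmetric] rin_simps rin_commute[of y x])

lemma rin_ext:
  assumes "\<And>y. rin x y = rin z y"
  shows "x = z"
proof -
  have "rin (x - z) (x - z) = 0" using assms[of "x - z"] by (simp only: rin.diff_left)
  then show ?thesis by (simp add: rin_self)
qed

text \<open>The complex inner product is recovered from its real part by multiplication with the
  imaginary unit. Orthogonality and symmetry can thus be handled over the reals, and complex
  linearity survives only as compatibility with \<open>cscale\<close>.\<close>

lemma Im_cinner: "Im (cinner x y) = - rin x (cscale \<i> y)"
  by (simp add: rin_def cinner_cscale_right)

lemma cinner_cscale_left: "cinner (cscale c x) y = cnj c * cinner x y"
  by (metis cinner_conj cinner_cscale_right complex_cnj_cnj complex_cnj_mult)

lemma rin_cscale_left: "rin (cscale c x) y = rin x (cscale (cnj c) y)"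
  by (simp add: rin_def cinner_cscale_left cinner_cscale_right)

lemma norm_cscale: "norm (cscale c (x::'a::chilbert_space)) = cmod c * norm x"
proof -
  have "(norm (cscale c x))\<^sup>2 = rin x (cscale (cnj c * c) x)"
    by (simp add: rin_self[symmetric] rin_cscale_left cscale_cscale)
  also have "\<dots> = (cmod c)\<^sup>2 * (norm x)\<^sup>2"
    by (simp add: rin_def cinner_cscale_right rin_self[symmetric]
        complex_norm_square[symmetric] mult.commute[of "cnj c"] flip: of_real_power)
  finally show ?thesis
    by (metis mult_nonneg_nonneg norm_ge_zero power2_eq_imp_eq power_mult_distrib)
qed

lemma bounded_linear_cscale: "bounded_linear (cscale c :: 'a::chilbert_space \<Rightarrow> 'a)"
proof
  show "\<exists>K. \<forall>x::'a. norm (cscale c x) \<le> norm x * K"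
    by (intro exI[of _ "cmod c"]) (simp add: norm_cscale)
qed (simp_all add: cscale_add_right scaleR_cscale cscale_cscale mult.commute)

section \<open>Orthogonal decomposition and adjoints\<close>

lemma orthogonal_decomposition:
  fixes M :: "'a::chilbert_space set"
  assumes cl: "closed M" and sub: "subspace M"
  obtains m where "m \<in> M" "\<And>y. y \<in> M \<Longrightarrow> rin (x - m) y = 0"
proof -
  define D where "D = (\<lambda>y. (norm (x - y))\<^sup>2) ` M"
  define d where "d = Inf D"
  have ne: "D \<noteq> {}" using subspace_0[OF sub] by (auto simp: D_def)
  have bd: "bdd_below D" unfolding D_def by (rule bdd_belowI[of _ 0]) auto
  have dle: "d \<le> (norm (x - y))\<^sup>2" if "y \<in> M" for y
    unfolding d_def using that bd by (intro cInf_lower) (auto simp: D_def)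
  have "\<exists>y\<in>M. (norm (x - y))\<^sup>2 < d + 1 / real (Suc n)" for n
    using cInf_lessD[OF ne, of "d + 1 / real (Suc n)"] by (auto simp: d_def D_def)
  then obtain s where sM: "\<And>n. s n \<in> M" and s: "\<And>n. (norm (x - s n))\<^sup>2 < d + 1 / real (Suc n)"
    by metis
  \<comment> \<open>The midpoint of \<open>s i\<close> and \<open>s j\<close> lies in
    \<open>M\<close>, so its squared distance to \<open>x\<close> is at least \<open>d\<close>; the
    parallelogram law turns this into a bound on the gap.\<close>
  have par: "(norm (s i - s j))\<^sup>2 \<le> 2 / real (Suc i) + 2 / real (Suc j)" for i j
  proof -
    define u v where "u = x - s i" and "v = x - s j"
    have "x - (1/2) *\<^sub>R (s i + s j) = (1/2) *\<^sub>R (u + v)"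
      by (simp add: u_def v_def algebra_simps flip: scaleR_left_distrib)
    moreover have "(1/2) *\<^sub>R (s i + s j) \<in> M" using sM sub by (simp add: subspace_add subspace_scale)
    ultimately have "d \<le> (norm ((1/2) *\<^sub>R (u + v)))\<^sup>2" using dle by metis
    then have "4 * d \<le> (norm (u + v))\<^sup>2" by (simp add: power_divide power_mult_distrib)
    moreover have "(norm (u + v))\<^sup>2 + (norm (u - v))\<^sup>2 = 2 * (norm u)\<^sup>2 + 2 * (norm v)\<^sup>2"
      by (simp add: norm_add_sq norm_diff_sq)
    moreover have "norm (u - v) = norm (s i - s j)" by (simp add: u_def v_def norm_minus_commute)
    ultimately show ?thesis using s[of i] s[of j] unfolding u_def v_def by simp
  qed
  have "Cauchy s"
  proof (rule CauchyI)
    fix e :: real assume e: "0 < e"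
    obtain N where N: "inverse (real (Suc N)) < e\<^sup>2 / 4" using reals_Archimedean[of "e\<^sup>2 / 4"] e by auto
    have "norm (s i - s j) < e" if "i \<ge> N" "j \<ge> N" for i j
    proof -
      have "1 / real (Suc i) \<le> inverse (real (Suc N))" "1 / real (Suc j) \<le> inverse (real (Suc N))"
        using that by (simp_all add: field_simps)
      then have "(norm (s i - s j))\<^sup>2 < e\<^sup>2" using par[of i j] N by simp
      then show ?thesis using e by (simp add: power2_less_imp_less)
    qed
    then show "\<exists>M. \<forall>m\<ge>M. \<forall>n\<ge>M. norm (s m - s n) < e" by blast
  qed
  then obtain m where lim: "s \<longlonglongrightarrow> m" using Cauchy_convergent convergent_def by blast
  have mM: "m \<in> M" using cl lim sM closed_sequentially by blast
  have "(\<lambda>n. (norm (x - s n))\<^sup>2) \<longlonglongrightarrow> (norm (x - m))\<^sup>2" by (intro tendsto_intros lim)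
  moreover have "(\<lambda>n. d + 1 / real (Suc n)) \<longlonglongrightarrow> d + 0"
    by (intro tendsto_add tendsto_const LIMSEQ_Suc[OF lim_const_over_n])
  ultimately have mle: "(norm (x - m))\<^sup>2 \<le> d"
    using LIMSEQ_le s by (metis (no_types, lifting) add_0_right less_imp_le)
  have "rin (x - m) y = 0" if y: "y \<in> M" for y
  proof (cases "y = 0")
    case False
    \<comment> \<open>\<open>m + t *\<^sub>R y\<close> is the point nearest to \<open>x\<close> on
      the line through \<open>m\<close> in direction \<open>y\<close>. As \<open>m\<close> is
      already optimal, \<open>t\<close> must vanish.\<close>
    define t where "t = rin (x - m) y / (norm y)\<^sup>2"
    have n0: "(norm y)\<^sup>2 > 0" using False by simp
    have "m + t *\<^sub>R y \<in> M" using mM y sub by (simp add: subspace_add subspace_scale)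
    from dle[OF this] have "(norm (x - m))\<^sup>2 \<le> (norm ((x - m) - t *\<^sub>R y))\<^sup>2"
      using mle by (metis diff_diff_add order_trans)
    also have "\<dots> = (norm (x - m))\<^sup>2 - 2 * t * rin (x - m) y + t\<^sup>2 * (norm y)\<^sup>2"
      unfolding norm_diff_sq[of "x - m"] by (simp add: rin.scaleR_right power_mult_distrib)
    also have "2 * t * rin (x - m) y = 2 * (t\<^sup>2 * (norm y)\<^sup>2)"
      using n0 by (simp add: t_def power2_eq_square)
    finally have "t\<^sup>2 * (norm y)\<^sup>2 \<le> 0" by simp
    then have "t = 0" using n0 by (simp add: mult_le_0_iff)
    then show ?thesis using n0 by (simp add: t_def)
  qed simp
  with mM show thesis using that by blast
qed

text \<open>A vector orthogonal to the kernel of \<open>g\<close> but outside it determines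
  \<open>g\<close> up to a factor, because subtracting a suitable multiple of it moves any
  \<open>y\<close> into the kernel.\<close>

lemma riesz_representation:
  fixes g :: "'a::chilbert_space \<Rightarrow> real"
  assumes "bounded_linear g"
  obtains z where "\<And>y. g y = rin z y"
proof -
  interpret g: bounded_linear g by fact
  define M where "M = {y. g y = 0}"
  have "closed M" unfolding M_def
    by (intro closed_Collect_eq continuous_intros g.continuous_on)
  moreover have "subspace M" by (auto simp: M_def subspace_def g.add g.scaleR)
  ultimately have dec: "\<exists>m\<in>M. \<forall>y\<in>M. rin (x - m) y = 0" for x
    using orthogonal_decomposition by metis
  show thesis
  proof (cases "\<forall>y. g y = 0")
    case True then show ?thesis using that[of 0] by simp
  next
    case False
    then obtain x where x: "g x \<noteq> 0" by blast
    obtain m where m: "m \<in> M" "\<And>y. y \<in> M \<Longrightarrow> rin (x - m) y = 0" using dec by blast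
    define z where "z = x - m"
    have gz: "g z \<noteq> 0" using m(1) x by (simp add: z_def M_def g.diff)
    then have z0: "(norm z)\<^sup>2 \<noteq> 0" by auto
    have "g y = rin ((g z / (norm z)\<^sup>2) *\<^sub>R z) y" for y
    proof -
      have "y - (g y / g z) *\<^sub>R z \<in> M" using gz by (simp add: M_def g.diff g.scaleR)
      then have "rin z (y - (g y / g z) *\<^sub>R z) = 0" using m(2) z_def by blast
      then have "rin z y = (g y / g z) * (norm z)\<^sup>2" by (simp add: rin_simps rin_self)
      then show ?thesis using z0 gz by (simp add: rin_simps)
    qed
    then show ?thesis using that by blast
  qed
qed

section \<open>Adjoints and symmetric operators\<close>

lemma bounded_op_linear: "bounded_op T \<Longrightarrow> bounded_linear T"
  by (simp add: bounded_op_def)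

lemma bounded_op_cscale: "bounded_op T \<Longrightarrow> T (cscale c x) = cscale c (T x)"
  by (simp add: bounded_op_def)

text \<open>Imaginary parts are real parts after multiplication of the second argument by the
  imaginary unit, and \<open>T\<close> commutes with that multiplication.\<close>

lemma cinner_adjoint_iff_rin:
  assumes T: "\<And>c x. T (cscale c x) = cscale c (T x)"
  shows "(\<forall>x y. cinner (S x) y = cinner x (T y)) \<longleftrightarrow> (\<forall>x y. rin (S x) y = rin x (T y))"
proof
  assume r: "\<forall>x y. rin (S x) y = rin x (T y)"
  show "\<forall>x y. cinner (S x) y = cinner x (T y)"
  proof (intro allI complex_eqI)
    fix x y
    show "Re (cinner (S x) y) = Re (cinner x (T y))" using r by (simp add: rin_def)
    show "Im (cinner (S x) y) = Im (cinner x (T y))" using r by (simp add: Im_cinner T[symmetric])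
  qed
qed (simp add: rin_def)

text \<open>\<open>adj\<close> is only a choice; the Riesz representation of
  \<open>y \<mapsto> rin x (T y)\<close> supplies a witness, so the chosen operator has the defining
  property.\<close>

lemma rin_adj:
  assumes "bounded_op T"
  shows "rin (adj T x) y = rin x (T y)"
proof -
  have "\<exists>z. \<forall>y. rin x (T y) = rin z y" for x
    using riesz_representation[OF bounded_linear_compose[OF rin.bounded_linear_right bounded_op_linear[OF assms]]]
    by metis
  then obtain S where "\<forall>x y. rin (S x) y = rin x (T y)" by metis
  then have "\<exists>S. \<forall>x y. cinner (S x) y = cinner x (T y)"
    using cinner_adjoint_iff_rin bounded_op_cscale[OF assms] by blast
  then have "\<forall>x y. cinner (adj T x) y = cinner x (T y)" unfolding adj_def by (rule someI_ex)
  then show ?thesis by (simp add: rin_def)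
qed

lemma adj_eqI:
  assumes "bounded_op T" "\<And>x y. rin (S x) y = rin x (T y)"
  shows "adj T = S"
  using assms rin_adj[OF assms(1)] by (intro ext rin_ext) simp

lemma bounded_op_adj:
  assumes "bounded_op T"
  shows "bounded_op (adj T)"
proof -
  interpret T: bounded_linear T by (rule bounded_op_linear[OF assms])
  obtain K where K: "\<And>x. norm (T x) \<le> norm x * K" using T.bounded by blast
  have "bounded_linear (adj T)"
  proof
    show "adj T (x + y) = adj T x + adj T y" for x y
      by (rule rin_ext) (simp add: rin_adj[OF assms] rin_simps)
    show "adj T (r *\<^sub>R x) = r *\<^sub>R adj T x" for r x
      by (rule rin_ext) (simp add: rin_adj[OF assms] rin_simps)
    have "norm (adj T x) \<le> norm x * K" for x
    proof (cases "adj T x = 0")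
      case True
      have "0 \<le> norm x * K" using K[of x] norm_ge_zero order_trans by blast
      then show ?thesis using True by simp
    next
      case False
      \<comment> \<open>Testing \<open>adj T x\<close> against itself transfers the bound of
        \<open>T\<close>; one factor is then cancelled.\<close>
      have "norm (adj T x) * norm (adj T x) = rin x (T (adj T x))"
        by (simp add: rin_adj[OF assms, symmetric] rin_self power2_eq_square)
      also have "\<dots> \<le> norm x * norm (T (adj T x))" by (rule rin_le_norm)
      also have "\<dots> \<le> norm x * (norm (adj T x) * K)" by (intro mult_left_mono K) simp
      finally show ?thesis using False by (simp add: mult.commute mult.left_commute)
    qed
    then show "\<exists>K. \<forall>x. norm (adj T x) \<le> norm x * K" by blast
  qed
  moreover have "adj T (cscale c x) = cscale c (adj T x)" for c x
    by (rule rin_ext) (simp add: rin_adj[OF assms] rin_cscale_left bounded_op_cscale[OF assms])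
  ultimately show ?thesis by (simp add: bounded_op_def)
qed

text \<open>Self-adjointness phrased with \<open>rin\<close>, which keeps the choice operator inside
  \<open>adj\<close> out of later arguments.\<close>

definition symmetric_op :: "('a::chilbert_space \<Rightarrow> 'a) \<Rightarrow> bool" where
  "symmetric_op T \<longleftrightarrow> bounded_op T \<and> (\<forall>x y. rin (T x) y = rin x (T y))"

lemma symmetric_op_iff_adj: "symmetric_op T \<longleftrightarrow> bounded_op T \<and> adj T = T"
  unfolding symmetric_op_def using adj_eqI[of T T] rin_adj[of T] by metis

lemma symmetric_op_rin: "symmetric_op T \<Longrightarrow> rin (T x) y = rin x (T y)"
  by (simp add: symmetric_op_def)

lemma symmetric_op_linear: "symmetric_op T \<Longrightarrow> bounded_linear T"
  by (simp add: symmetric_op_def bounded_op_def)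

lemma symmetric_op_cscale: "symmetric_op T \<Longrightarrow> T (cscale c x) = cscale c (T x)"
  by (simp add: symmetric_op_def bounded_op_def)

lemma symmetric_op_add:
  "symmetric_op S \<Longrightarrow> symmetric_op T \<Longrightarrow> symmetric_op (\<lambda>x. S x + T x)"
  by (auto simp: symmetric_op_def bounded_op_def rin_simps cscale_add_right intro: bounded_linear_add)

lemma symmetric_op_scaleR:
  "symmetric_op S \<Longrightarrow> symmetric_op (\<lambda>x. r *\<^sub>R S x)"
  by (auto simp: symmetric_op_def bounded_op_def rin_simps linear_simps[OF bounded_linear_cscale]
      intro: bounded_linear_const_scaleR)

lemma symmetric_op_diff:
  "symmetric_op S \<Longrightarrow> symmetric_op T \<Longrightarrow> symmetric_op (\<lambda>x. S x - T x)"
  using symmetric_op_add[of S "\<lambda>x. (-1) *\<^sub>R T x"] symmetric_op_scaleR[of T "-1"] by simp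

lemma symmetric_op_zero: "symmetric_op (\<lambda>x. 0)"
  by (simp add: symmetric_op_def bounded_op_def linear_simps[OF bounded_linear_cscale])

lemma symmetric_op_id: "symmetric_op (\<lambda>x. x)"
  by (simp add: symmetric_op_def bounded_op_def bounded_linear_ident)

lemma symmetric_op_sum:
  "finite I \<Longrightarrow> (\<And>i. i \<in> I \<Longrightarrow> symmetric_op (S i)) \<Longrightarrow> symmetric_op (\<lambda>x. \<Sum>i\<in>I. S i x)"
  by (induction I rule: finite_induct) (auto intro: symmetric_op_zero symmetric_op_add)

lemma symmetric_op_commuting_comp:
  assumes "symmetric_op S" "symmetric_op T" "\<And>x. S (T x) = T (S x)"
  shows "symmetric_op (\<lambda>x. S (T x))"
  using assms by (auto simp: symmetric_op_def bounded_op_def intro: bounded_linear_compose)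

text \<open>Linearity and symmetry are pointwise identities and pass to the strong limit;
  boundedness of the limit comes from the common bound \<open>K\<close>.\<close>

lemma symmetric_op_lim:
  assumes S: "\<And>n::nat. symmetric_op (S n)" and lim: "\<And>x. (\<lambda>n. S n x) \<longlonglongrightarrow> T x"
    and bd: "\<And>n x. norm (S n x) \<le> K * norm x"
  shows "symmetric_op T"
proof -
  have "bounded_linear T"
  proof
    fix x y r
    have "(\<lambda>n. S n (x + y)) \<longlonglongrightarrow> T x + T y"
      using tendsto_add[OF lim lim] by (simp add: linear_simps(1)[OF symmetric_op_linear[OF S]])
    then show "T (x + y) = T x + T y" using lim LIMSEQ_unique by blast
    have "(\<lambda>n. S n (r *\<^sub>R x)) \<longlonglongrightarrow> r *\<^sub>R T x"
      using tendsto_scaleR[OF tendsto_const lim] by (simp add: linear_simps(5)[OF symmetric_op_linear[OF S]])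
    then show "T (r *\<^sub>R x) = r *\<^sub>R T x" using lim LIMSEQ_unique by blast
    have "norm (T x) \<le> norm x * K" for x
      using LIMSEQ_le_const2[OF tendsto_norm[OF lim]] bd by (metis mult.commute)
    then show "\<exists>K. \<forall>x. norm (T x) \<le> norm x * K" by blast
  qed
  moreover have "T (cscale c x) = cscale c (T x)" for c x
  proof -
    have "(\<lambda>n. cscale c (S n x)) \<longlonglongrightarrow> cscale c (T x)"
      by (rule bounded_linear.tendsto[OF bounded_linear_cscale lim])
    then have "(\<lambda>n. S n (cscale c x)) \<longlonglongrightarrow> cscale c (T x)" by (simp add: symmetric_op_cscale[OF S])
    then show ?thesis using lim LIMSEQ_unique by blast
  qed
  moreover have "rin (T x) y = rin x (T y)" for x y
  proof -
    have "(\<lambda>n. rin (S n x) y) \<longlonglongrightarrow> rin (T x) y" by (rule rin.tendsto[OF lim tendsto_const])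
    moreover have "(\<lambda>n. rin (S n x) y) \<longlonglongrightarrow> rin x (T y)"
      using rin.tendsto[OF tendsto_const lim] by (simp add: symmetric_op_rin[OF S])
    ultimately show ?thesis using LIMSEQ_unique by blast
  qed
  ultimately show ?thesis by (simp add: symmetric_op_def bounded_op_def)
qed

section \<open>Projections\<close>

lemma is_proj_iff: "is_proj P \<longleftrightarrow> symmetric_op P \<and> (\<forall>x. P (P x) = P x)"
  unfolding is_proj_def symmetric_op_iff_adj by (auto simp: fun_eq_iff)

lemma is_proj_symmetric: "is_proj P \<Longrightarrow> symmetric_op P"
  by (simp add: is_proj_iff)

lemma is_proj_idem: "is_proj P \<Longrightarrow> P (P x) = P x"
  by (simp add: is_proj_iff)

lemma is_proj_linear: "is_proj P \<Longrightarrow> bounded_linear P"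
  by (simp add: is_proj_iff symmetric_op_linear)

lemma is_proj_rin: "is_proj P \<Longrightarrow> rin (P x) y = rin x (P y)"
  by (simp add: is_proj_iff symmetric_op_rin)

lemma is_proj_rin_self: "is_proj P \<Longrightarrow> rin (P x) x = (norm (P x))\<^sup>2"
  by (metis is_proj_idem is_proj_rin rin_self)

lemma is_proj_range: "is_proj P \<Longrightarrow> x \<in> range P \<longleftrightarrow> P x = x"
  by (metis is_proj_idem rangeE rangeI)

lemma is_proj_norm_le: "is_proj P \<Longrightarrow> norm (P x) \<le> norm x"
proof -
  assume P: "is_proj P"
  have "norm (P x) * norm (P x) \<le> norm (P x) * norm x"
    using is_proj_rin_self[OF P, of x] rin_le_norm[of "P x" x] by (simp add: power2_eq_square)
  then show ?thesis by (cases "norm (P x) = 0") auto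
qed

lemma is_proj_zero: "is_proj (\<lambda>x. 0)"
  by (simp add: is_proj_iff symmetric_op_zero)

lemma is_proj_id: "is_proj id"
  by (simp add: is_proj_iff symmetric_op_id id_def)

lemma is_proj_compl: "is_proj P \<Longrightarrow> is_proj (\<lambda>x. x - P x)"
  by (auto simp: is_proj_iff symmetric_op_linear linear_simps(2)
      intro: symmetric_op_diff symmetric_op_id)

text \<open>Taking adjoints moves \<open>Q\<close> from the right of \<open>P\<close> to its left,
  where the relation reads as inclusion of ranges.\<close>

lemma proj_le_iff:
  assumes "is_proj P" "is_proj Q"
  shows "proj_le P Q \<longleftrightarrow> (\<forall>x. Q (P x) = P x)"
proof -
  have "proj_le P Q \<longleftrightarrow> (\<forall>x y. rin (P (Q x)) y = rin (P x) y)"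
    unfolding proj_le_def fun_eq_iff using rin_ext by (metis comp_apply)
  also have "\<dots> \<longleftrightarrow> (\<forall>x y. rin x (Q (P y)) = rin x (P y))"
    by (simp add: is_proj_rin assms)
  also have "\<dots> \<longleftrightarrow> (\<forall>x. Q (P x) = P x)"
    using rin_ext by (metis rin_commute)
  finally show ?thesis .
qed

lemma proj_le_apply:
  assumes "proj_le P Q" "is_proj P" "is_proj Q"
  shows "Q (P x) = P x" "P (Q x) = P x"
  using assms(1) proj_le_iff[OF assms(2,3)] by (auto simp: proj_le_def fun_eq_iff)

lemma proj_le_refl: "is_proj P \<Longrightarrow> proj_le P P"
  by (simp add: proj_le_iff is_proj_idem)

lemma proj_le_trans: "proj_le P Q \<Longrightarrow> proj_le Q T \<Longrightarrow> proj_le P T"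
  unfolding proj_le_def by (metis comp_assoc)

lemma proj_le_antisym:
  assumes "proj_le P Q" "proj_le Q P" "is_proj P" "is_proj Q"
  shows "P = Q"
  using proj_le_apply[OF assms(1,3,4)] assms(2) by (auto simp: proj_le_def fun_eq_iff)

text \<open>The projection is the nearest-point map. Orthogonality of the remainder characterises
  its values, and each algebraic law follows by checking that characterisation.\<close>

lemma proj_exists:
  fixes M :: "'a::chilbert_space set"
  assumes "closed M" "subspace M" and cs: "\<And>c x. x \<in> M \<Longrightarrow> cscale c x \<in> M"
  obtains P where "is_proj P" "range P = M"
proof -
  have "\<exists>m. m \<in> M \<and> (\<forall>y\<in>M. rin (x - m) y = 0)" for x
    using orthogonal_decomposition[OF assms(1,2)] by metis
  then obtain P where PM: "\<And>x. P x \<in> M" and P: "\<And>x y. y \<in> M \<Longrightarrow> rin (x - P x) y = 0" by metis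
  have uniq: "P x = m" if "m \<in> M" "\<And>y. y \<in> M \<Longrightarrow> rin (x - m) y = 0" for x m
  proof -
    have d: "P x - m \<in> M" using PM that assms(2) by (simp add: subspace_diff)
    have "rin (x - m) (P x - m) - rin (x - P x) (P x - m) = rin (P x - m) (P x - m)"
      by (simp add: rin_simps)
    then show ?thesis using P[OF d] that(2)[OF d] by (simp add: rin_self)
  qed
  have idem: "P x = x" if "x \<in> M" for x by (rule uniq) (simp_all add: that)
  have nrm: "norm (P x) \<le> norm x" for x
  proof -
    have "(norm x)\<^sup>2 = (norm ((x - P x) + P x))\<^sup>2" by simp
    also have "\<dots> = (norm (x - P x))\<^sup>2 + (norm (P x))\<^sup>2" by (subst norm_add_sq) (simp add: P PM)
    finally show ?thesis by (metis abs_le_square_iff abs_norm_cancel le_add_same_cancel2 zero_le_power2)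
  qed
  have "bounded_linear P"
  proof
    show "P (x + y) = P x + P y" for x y
    proof (rule uniq)
      show "P x + P y \<in> M" using PM assms(2) by (simp add: subspace_add)
      show "rin (x + y - (P x + P y)) z = 0" if "z \<in> M" for z
        using P[OF that, of x] P[OF that, of y] by (simp add: rin_simps)
    qed
    show "P (r *\<^sub>R x) = r *\<^sub>R P x" for r x
    proof (rule uniq)
      show "r *\<^sub>R P x \<in> M" using PM assms(2) by (simp add: subspace_scale)
      show "rin (r *\<^sub>R x - r *\<^sub>R P x) z = 0" if "z \<in> M" for z
        using P[OF that, of x] by (simp add: rin_simps)
    qed
    show "\<exists>K. \<forall>x. norm (P x) \<le> norm x * K" using nrm by (intro exI[of _ 1]) simp
  qed
  moreover have "P (cscale c x) = cscale c (P x)" for c x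
  proof (rule uniq)
    show "cscale c (P x) \<in> M" using PM cs by blast
    \<comment> \<open>The scalar moves to \<open>z\<close> as its conjugate, and \<open>M\<close> is
      invariant under that too.\<close>
    show "rin (cscale c x - cscale c (P x)) z = 0" if "z \<in> M" for z
      using P[OF cs[OF that, of "cnj c"], of x] by (simp add: rin_simps rin_cscale_left)
  qed
  moreover have "rin (P x) y = rin x (P y)" for x y
    using P[OF PM[of y], of x] P[OF PM[of x], of y]
    by (simp add: rin_simps rin_commute[of y] rin_commute[of "P y"])
  ultimately have "is_proj P" by (simp add: is_proj_iff symmetric_op_def bounded_op_def idem PM)
  moreover have "range P = M" using PM idem by (metis image_subset_iff rangeI subsetI subset_antisym)
  ultimately show thesis using that by blast
qed

text \<open>The common fixed space is closed and complex-linear, hence the range of a projection. An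
  empty \<open>I\<close> yields the identity.\<close>

lemma proj_exists_INT:
  fixes E :: "'i \<Rightarrow> 'a::chilbert_space \<Rightarrow> 'a"
  assumes "\<And>i. i \<in> I \<Longrightarrow> is_proj (E i)"
  obtains P where "is_proj P" "\<And>x. P x = x \<longleftrightarrow> (\<forall>i\<in>I. E i x = x)"
proof -
  define M where "M = (\<Inter>i\<in>I. {x. E i x = x})"
  have "closed M" unfolding M_def
    by (intro closed_INT ballI closed_Collect_eq linear_continuous_on is_proj_linear assms continuous_intros)
  moreover have "subspace M"
    by (auto simp: M_def subspace_def linear_simps[OF is_proj_linear[OF assms]])
  moreover have "cscale c x \<in> M" if "x \<in> M" for c x
    using that by (auto simp: M_def symmetric_op_cscale[OF is_proj_symmetric[OF assms]])
  ultimately obtain P where "is_proj P" "range P = M" using proj_exists by metis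
  then show thesis using that[of P] is_proj_range[of P] by (auto simp: M_def)
qed

text \<open>Invariance under \<open>adj U\<close> makes the orthogonal complement of the range
  invariant under \<open>U\<close>, so \<open>U\<close> respects the whole decomposition.\<close>

lemma proj_commute_invariant:
  assumes P: "is_proj P" and U: "bounded_op U"
    and inv: "\<And>x. P x = x \<Longrightarrow> P (U x) = U x" "\<And>x. P x = x \<Longrightarrow> P (adj U x) = adj U x"
  shows "U (P x) = P (U x)"
proof (rule rin_ext)
  fix y
  have "rin (P (U x)) y = rin x (adj U (P y))"
    by (metis P U is_proj_rin rin_adj rin_commute)
  also have "\<dots> = rin x (P (adj U (P y)))" using inv(2)[of "P y"] is_proj_idem[OF P] by simp
  also have "\<dots> = rin (P (U (P x))) y"
    by (metis P U is_proj_rin rin_adj rin_commute)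
  also have "P (U (P x)) = U (P x)" using inv(1)[of "P x"] is_proj_idem[OF P] by simp
  finally show "rin (U (P x)) y = rin (P (U x)) y" by simp
qed

section \<open>Spectral cuts and Riemann--Stieltjes sums\<close>

text \<open>Polarisation at \<open>x\<close> and at the multiple of \<open>T x\<close> of the same
  length. The version on an invariant subspace serves to bound an operator on the range of a
  projection.\<close>

lemma norm_le_of_form_bound:
  fixes T :: "'a::chilbert_space \<Rightarrow> 'a"
  assumes T: "symmetric_op T" and M: "subspace M" and inv: "\<And>x. x \<in> M \<Longrightarrow> T x \<in> M"
    and bd: "\<And>x. x \<in> M \<Longrightarrow> \<bar>rin (T x) x\<bar> \<le> k * (norm x)\<^sup>2" and x: "x \<in> M"
  shows "norm (T x) \<le> k * norm x"
proof (cases "x = 0 \<or> T x = 0")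
  case True
  then show ?thesis
  proof
    assume "x = 0" then show ?thesis by (simp add: linear_simps[OF symmetric_op_linear[OF T]])
  next
    assume T0: "T x = 0"
    have "0 \<le> k * (norm x)\<^sup>2" using bd[OF x] by (simp add: T0)
    then show ?thesis using T0 by (cases "norm x = 0") (auto simp: zero_le_mult_iff)
  qed
next
  case False
  define y where "y = (norm x / norm (T x)) *\<^sub>R T x"
  have ny: "norm y = norm x" using False by (simp add: y_def)
  have yM: "y \<in> M" using inv x M by (simp add: y_def subspace_scale)
  note lin = linear_simps[OF symmetric_op_linear[OF T]]
  have "4 * rin (T x) y = rin (T (x + y)) (x + y) - rin (T (x - y)) (x - y)"
    using symmetric_op_rin[OF T, of y x] by (simp add: lin rin_simps rin_commute[of y])
  also have "\<dots> \<le> k * (norm (x + y))\<^sup>2 + k * (norm (x - y))\<^sup>2"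
    using bd[of "x + y"] bd[of "x - y"] x yM M by (simp add: subspace_add subspace_diff abs_le_iff)
  also have "\<dots> = 4 * k * (norm x)\<^sup>2"
    by (simp add: norm_add_sq norm_diff_sq ny algebra_simps)
  finally have "rin (T x) y \<le> k * (norm x)\<^sup>2" by simp
  moreover have "rin (T x) y = norm x * norm (T x)"
    using False by (simp add: y_def rin_simps rin_self power2_eq_square)
  ultimately have "norm x * norm (T x) \<le> norm x * (k * norm x)" by (simp add: power2_eq_square algebra_simps)
  then show ?thesis using False by simp
qed

text \<open>The tolerance \<open>e\<close> is made for Riemann--Stieltjes sums, which separate at
  \<open>l\<close> only up to their mesh; \<open>e = 0\<close> is the exact notion.\<close>

definition spectral_cut :: "('a::chilbert_space \<Rightarrow> 'a) \<Rightarrow> real \<Rightarrow> ('a \<Rightarrow> 'a) \<Rightarrow> real \<Rightarrow> bool" where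
  "spectral_cut A e P l \<longleftrightarrow> (\<forall>x. A (P x) = P (A x)) \<and>
     (\<forall>x. P x = x \<longrightarrow> rin (A x) x \<le> (l + e) * (norm x)\<^sup>2) \<and>
     (\<forall>x. P x = 0 \<longrightarrow> (l - e) * (norm x)\<^sup>2 \<le> rin (A x) x)"

lemma le_of_forall_pos_mult:
  fixes u v c :: real
  assumes "\<And>e. e > 0 \<Longrightarrow> u \<le> v + e * c"
  shows "u \<le> v"
proof (rule field_le_epsilon)
  fix e :: real assume e: "0 < e"
  \<comment> \<open>The added \<open>1\<close> keeps the denominator positive when
    \<open>c = 0\<close>.\<close>
  have "u \<le> v + e / (\<bar>c\<bar> + 1) * c" using assms[of "e / (\<bar>c\<bar> + 1)"] e by simp
  moreover have "e / (\<bar>c\<bar> + 1) * c \<le> e / (\<bar>c\<bar> + 1) * (\<bar>c\<bar> + 1)"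
    using e by (intro mult_left_mono) auto
  ultimately show "u \<le> v + e" by simp
qed

text \<open>Replacing \<open>A\<close> by a nearby \<open>S\<close> changes each of the three
  conditions by a multiple of \<open>e\<close> that depends only on \<open>x\<close>, and
  \<open>e\<close> is arbitrary.\<close>

lemma spectral_cut_approx:
  assumes P: "is_proj P" and A: "bounded_linear A"
    and approx: "\<And>e. e > 0 \<Longrightarrow> \<exists>S. spectral_cut S e P l \<and> (\<forall>x. norm (A x - S x) \<le> e * norm x)"
  shows "spectral_cut A 0 P l"
proof -
  have comm: "A (P x) = P (A x)" for x
  proof -
    have "norm (A (P x) - P (A x)) \<le> 0 + e * (2 * norm x)" if e: "e > 0" for e
    proof -
      obtain S where S: "spectral_cut S e P l" "\<And>x. norm (A x - S x) \<le> e * norm x"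
        using approx[OF e] by blast
      have SP: "S (P x) = P (S x)" using S(1) by (simp add: spectral_cut_def)
      have "A (P x) - P (A x) = (A (P x) - S (P x)) - P (A x - S x)"
        by (simp add: SP linear_simps[OF is_proj_linear[OF P]])
      then have "norm (A (P x) - P (A x)) \<le> norm (A (P x) - S (P x)) + norm (P (A x - S x))"
        by (metis norm_triangle_ineq4)
      also have "\<dots> \<le> e * norm (P x) + norm (A x - S x)"
        by (intro add_mono S(2) is_proj_norm_le P)
      also have "\<dots> \<le> e * norm x + e * norm x"
        using e by (intro add_mono S(2) mult_left_mono is_proj_norm_le P) auto
      finally show ?thesis by simp
    qed
    from le_of_forall_pos_mult[OF this] show ?thesis by simp
  qed
  have near: "\<bar>rin (A x) x - rin (S x) x\<bar> \<le> e * (norm x)\<^sup>2" if "\<And>x. norm (A x - S x) \<le> e * norm x" for S e x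
  proof -
    have "\<bar>rin (A x - S x) x\<bar> \<le> norm (A x - S x) * norm x" by (rule abs_rin_le_norm)
    also have "\<dots> \<le> e * norm x * norm x" by (intro mult_right_mono that) simp
    finally show ?thesis by (simp add: rin_simps power2_eq_square mult.assoc)
  qed
  have up: "rin (A x) x \<le> l * (norm x)\<^sup>2" if x: "P x = x" for x
  proof (rule le_of_forall_pos_mult)
    fix e :: real assume e: "e > 0"
    obtain S where S: "spectral_cut S e P l" "\<And>x. norm (A x - S x) \<le> e * norm x"
      using approx[OF e] by blast
    have "rin (S x) x \<le> (l + e) * (norm x)\<^sup>2" using S(1) x by (simp add: spectral_cut_def)
    then show "rin (A x) x \<le> l * (norm x)\<^sup>2 + e * (2 * (norm x)\<^sup>2)"
      using near[OF S(2), of x] by (simp add: algebra_simps abs_le_iff)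
  qed
  have lo: "l * (norm x)\<^sup>2 \<le> rin (A x) x" if x: "P x = 0" for x
  proof (rule le_of_forall_pos_mult)
    fix e :: real assume e: "e > 0"
    obtain S where S: "spectral_cut S e P l" "\<And>x. norm (A x - S x) \<le> e * norm x"
      using approx[OF e] by blast
    have "(l - e) * (norm x)\<^sup>2 \<le> rin (S x) x" using S(1) x by (simp add: spectral_cut_def)
    then show "l * (norm x)\<^sup>2 \<le> rin (A x) x + e * (2 * (norm x)\<^sup>2)"
      using near[OF S(2), of x] by (simp add: algebra_simps abs_le_iff)
  qed
  show ?thesis using comm up lo by (simp add: spectral_cut_def)
qed

section \<open>Riemann--Stieltjes sums along a resolution of the identity\<close>

lemma is_proj_diff:
  assumes "is_proj P" "is_proj Q" "proj_le P Q"
  shows "is_proj (\<lambda>x. Q x - P x)"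
  using assms proj_le_apply[OF assms(3,1,2)] unfolding is_proj_iff
  by (auto simp: symmetric_op_linear linear_simps(2) intro: symmetric_op_diff)

text \<open>Together with \<open>rs_sum\<close> this names the condition and the sum that occur
  inside \<open>spectral_family\<close>, in the same shape, so that unfolding identifies
  them.\<close>

definition tagged_partition :: "real \<Rightarrow> real \<Rightarrow> real \<Rightarrow> nat \<Rightarrow> (nat \<Rightarrow> real) \<Rightarrow> (nat \<Rightarrow> real) \<Rightarrow> bool" where
  "tagged_partition a b d n t s \<longleftrightarrow> n > 0 \<and> t 0 = a \<and> t n = b \<and>
     (\<forall>i<n. t i < t (Suc i) \<and> t (Suc i) - t i < d \<and> t i \<le> s i \<and> s i \<le> t (Suc i))"

definition rs_sum :: "(real \<Rightarrow> 'a::chilbert_space \<Rightarrow> 'a) \<Rightarrow> nat \<Rightarrow> (nat \<Rightarrow> real) \<Rightarrow> (nat \<Rightarrow> real) \<Rightarrow> 'a \<Rightarrow> 'a" where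
  "rs_sum E n t s x = (\<Sum>i<n. s i *\<^sub>R (E (t (Suc i)) x - E (t i) x))"

lemma tagged_partition_exists:
  assumes "a < b" "d > 0"
  obtains n t s where "tagged_partition a b d n t s"
proof -
  obtain n :: nat where n: "real n > (b - a) / d" using reals_Archimedean2 by blast
  moreover have "(b - a) / d > 0" using assms by simp
  ultimately have n0: "real n > 0" by linarith
  define t where "t = (\<lambda>i::nat. a + real i * ((b - a) / real n))"
  have step: "t (Suc i) - t i = (b - a) / real n" for i by (simp add: t_def distrib_right add_divide_distrib)
  have "(b - a) / real n < d" "(b - a) / real n > 0"
    using n n0 assms by (simp_all add: field_simps)
  then have "t i < t (Suc i) \<and> t (Suc i) - t i < d" for i using step[of i] by linarith
  \<comment> \<open>The left endpoints serve as tags, hence the repeated \<open>t\<close>.\<close>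
  then have "tagged_partition a b d n t t" using n0
    by (auto simp: tagged_partition_def less_imp_le) (simp_all add: t_def)
  then show thesis using that by blast
qed

text \<open>The conditions in \<open>spectral_family\<close> that mention neither the operator nor
  continuity; Riemann--Stieltjes sums can be formed and estimated from them.\<close>

locale proj_resolution =
  fixes E :: "real \<Rightarrow> 'a::chilbert_space \<Rightarrow> 'a" and a b :: real
  assumes proj: "is_proj (E l)"
    and mono: "l \<le> m \<Longrightarrow> proj_le (E l) (E m)"
    and ab: "a < b"
    and low: "l \<le> a \<Longrightarrow> E l = (\<lambda>x. 0)"
    and high: "b \<le> l \<Longrightarrow> E l = id"
begin

lemma E_E: "l \<le> m \<Longrightarrow> E m (E l x) = E l x" "l \<le> m \<Longrightarrow> E l (E m x) = E l x"
  using proj_le_apply[OF mono proj proj] by blast+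

lemma E_commute: "E l (E m x) = E m (E l x)"
  by (cases "l \<le> m") (simp_all add: E_E)

lemma E_diff: "E l (x - y) = E l x - E l y"
  using linear_simps(2)[OF is_proj_linear[OF proj]] .

lemma rs_sum_commute:
  assumes "bounded_linear U" "\<And>l x. U (E l x) = E l (U x)"
  shows "U (rs_sum E n t s x) = rs_sum E n t s (U x)"
  unfolding rs_sum_def using assms
  by (simp add: linear_sum[OF bounded_linear.linear[OF assms(1)]] linear_simps[OF assms(1)])

context
  fixes d n t s
  assumes part: "tagged_partition a b d n t s"
begin

definition D :: "nat \<Rightarrow> 'a \<Rightarrow> 'a" where
  "D i x = E (t (Suc i)) x - E (t i) x"

lemma t_less: "i < n \<Longrightarrow> t i < t (Suc i)"
  using part by (simp add: tagged_partition_def)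

lemma D_proj: "i < n \<Longrightarrow> is_proj (D i)"
  unfolding D_def by (intro is_proj_diff proj mono less_imp_le t_less)

lemma sum_D: "(\<Sum>i<n. D i x) = x"
proof -
  have "(\<Sum>i<n. D i x) = E (t n) x - E (t 0) x"
    unfolding D_def by (rule sum_lessThan_telescope)
  then show ?thesis using part by (simp add: tagged_partition_def low high)
qed

lemma rs_sum_D: "rs_sum E n t s x = (\<Sum>i<n. s i *\<^sub>R D i x)"
  by (simp add: rs_sum_def D_def)

text \<open>Pythagoras for the increments: \<open>rin (D i x) x\<close> is already the squared norm
  of \<open>D i x\<close>, and the increments sum to the identity.\<close>

lemma sum_norm_D: "(\<Sum>i<n. (norm (D i x))\<^sup>2) = (norm x)\<^sup>2"
proof -
  have "(norm x)\<^sup>2 = rin (\<Sum>i<n. D i x) x" by (simp add: sum_D rin_self)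
  then show ?thesis by (simp add: rin.sum_left is_proj_rin_self D_proj)
qed

lemma rin_rs_sum: "rin (rs_sum E n t s x) x = (\<Sum>i<n. s i * (norm (D i x))\<^sup>2)"
  by (simp add: rs_sum_D rin.sum_left rin_simps is_proj_rin_self D_proj)

lemma symmetric_rs_sum: "symmetric_op (rs_sum E n t s)"
  unfolding rs_sum_D[abs_def]
  by (intro symmetric_op_sum symmetric_op_scaleR is_proj_symmetric D_proj) auto

text \<open>\<open>A\<close> commutes with the increments, so its form splits along them. On the
  range of \<open>D i\<close> the form lies between \<open>t i - e\<close> and
  \<open>t (Suc i) + e\<close>, hence within \<open>d + e\<close> of the tag.\<close>

lemma rs_sum_estimate:
  assumes A: "symmetric_op A" and cut: "\<And>l. spectral_cut A e (E l) l"
  shows "norm (A x - rs_sum E n t s x) \<le> (d + e) * norm x"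
proof (rule norm_le_of_form_bound[where M = UNIV])
  show "symmetric_op (\<lambda>x. A x - rs_sum E n t s x)"
    by (intro symmetric_op_diff A symmetric_rs_sum)
  fix x
  note lin = linear_simps[OF symmetric_op_linear[OF A]]
  have comm: "A (D i x) = D i (A x)" for i x
    using cut by (simp add: D_def spectral_cut_def lin)
  have "A x = (\<Sum>i<n. A (D i x))"
    by (metis linear_sum[OF bounded_linear.linear[OF symmetric_op_linear[OF A]]] sum_D)
  then have "rin (A x) x = (\<Sum>i<n. rin (A (D i x)) x)" by (simp add: rin.sum_left)
  also have "\<dots> = (\<Sum>i<n. rin (A (D i x)) (D i x))"
  proof (rule sum.cong)
    fix i assume i: "i \<in> {..<n}"
    have "A (D i x) = D i (A (D i x))"
      using i by (metis comm D_proj is_proj_idem lessThan_iff)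
    then show "rin (A (D i x)) x = rin (A (D i x)) (D i x)"
      using i by (metis D_proj is_proj_rin lessThan_iff)
  qed simp
  finally have "rin (A x - rs_sum E n t s x) x
      = (\<Sum>i<n. rin (A (D i x)) (D i x) - s i * (norm (D i x))\<^sup>2)"
    by (simp add: rin.diff_left rin_rs_sum sum_subtractf)
  also have "\<bar>\<dots>\<bar> \<le> (\<Sum>i<n. (d + e) * (norm (D i x))\<^sup>2)"
  proof (rule sum_abs[THEN order_trans], rule sum_mono)
    fix i assume "i \<in> {..<n}"
    then have i: "i < n" by simp
    define y where "y = D i x"
    have tl: "t i \<le> t (Suc i)" using t_less[OF i] by simp
    have "E (t (Suc i)) y = y" "E (t i) y = 0"
      using tl by (simp_all add: y_def D_def E_diff E_E is_proj_idem[OF proj])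
    then have "rin (A y) y \<le> (t (Suc i) + e) * (norm y)\<^sup>2" "(t i - e) * (norm y)\<^sup>2 \<le> rin (A y) y"
      using cut by (simp_all add: spectral_cut_def)
    moreover have s: "t i \<le> s i" "s i \<le> t (Suc i)" "t (Suc i) \<le> t i + d"
      using part i by (auto simp: tagged_partition_def less_imp_le algebra_simps)
    have "(t (Suc i) + e) * (norm y)\<^sup>2 \<le> (s i + d + e) * (norm y)\<^sup>2"
        "(s i - d - e) * (norm y)\<^sup>2 \<le> (t i - e) * (norm y)\<^sup>2"
      using s by (auto intro!: mult_right_mono)
    ultimately show "\<bar>rin (A (D i x)) (D i x) - s i * (norm (D i x))\<^sup>2\<bar> \<le> (d + e) * (norm (D i x))\<^sup>2"
      unfolding y_def[symmetric] by (simp add: abs_le_iff algebra_simps)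
  qed
  also have "\<dots> = (d + e) * (norm x)\<^sup>2"
    by (simp only: sum_distrib_left[symmetric] sum_norm_D)
  finally show "\<bar>rin (A x - rs_sum E n t s x) x\<bar> \<le> (d + e) * (norm x)\<^sup>2" .
qed simp_all

text \<open>The sum acts as \<open>s i\<close> on the range of \<open>D i\<close>. Cells above
  \<open>l\<close> vanish on the range of \<open>E l\<close>, cells below \<open>l\<close> on its
  kernel, and the tag of a cell straddling \<open>l\<close> is within \<open>d\<close> of
  \<open>l\<close>.\<close>

lemma spectral_cut_rs_sum: "spectral_cut (rs_sum E n t s) d (E l) l"
  unfolding spectral_cut_def
proof (intro conjI allI impI)
  fix x
  show "rs_sum E n t s (E l x) = E l (rs_sum E n t s x)"
    by (rule rs_sum_commute[OF is_proj_linear[OF proj], symmetric]) (rule E_commute)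
next
  fix x assume x: "E l x = x"
  have "s i * (norm (D i x))\<^sup>2 \<le> (l + d) * (norm (D i x))\<^sup>2" if i: "i < n" for i
  proof (cases "t i \<ge> l")
    case True
    then have "t (Suc i) \<ge> l" using t_less[OF i] by simp
    then have "D i x = 0" using True x E_E(1) unfolding D_def by (metis cancel_comm_monoid_add_class.diff_cancel)
    then show ?thesis by simp
  next
    case False
    then have "s i \<le> l + d" using part i unfolding tagged_partition_def by fastforce
    then show ?thesis by (intro mult_right_mono) auto
  qed
  then have "rin (rs_sum E n t s x) x \<le> (\<Sum>i<n. (l + d) * (norm (D i x))\<^sup>2)"
    unfolding rin_rs_sum by (intro sum_mono) simp
  then show "rin (rs_sum E n t s x) x \<le> (l + d) * (norm x)\<^sup>2"
    by (simp only: sum_distrib_left[symmetric] sum_norm_D)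
next
  fix x assume x: "E l x = 0"
  have "(l - d) * (norm (D i x))\<^sup>2 \<le> s i * (norm (D i x))\<^sup>2" if i: "i < n" for i
  proof (cases "t (Suc i) \<le> l")
    case True
    have z: "E m x = 0" if "m \<le> l" for m
      using E_E(2)[OF that, of x] x by (simp add: linear_simps(3)[OF is_proj_linear[OF proj]])
    have "t i \<le> l" using True t_less[OF i] by simp
    then have "D i x = 0" using True unfolding D_def by (simp add: z)
    then show ?thesis by simp
  next
    case False
    then have "l - d \<le> s i" using part i unfolding tagged_partition_def by fastforce
    then show ?thesis by (intro mult_right_mono) auto
  qed
  then have "(\<Sum>i<n. (l - d) * (norm (D i x))\<^sup>2) \<le> rin (rs_sum E n t s x) x"
    unfolding rin_rs_sum by (intro sum_mono) simp
  then show "(l - d) * (norm x)\<^sup>2 \<le> rin (rs_sum E n t s x) x"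
    by (simp only: sum_distrib_left[symmetric] sum_norm_D)
qed

end

lemma spectral_familyI:
  assumes right: "\<And>l x. ((\<lambda>m. E m x) \<longlongrightarrow> E l x) (at_right l)"
    and A: "symmetric_op A" and cut: "\<And>l. spectral_cut A 0 (E l) l"
  shows "spectral_family A E"
proof -
  \<comment> \<open>With exact cuts the error is at most the mesh; halving \<open>e\<close> leaves
    room for the strict inequality.\<close>
  have "onorm (\<lambda>x. A x - rs_sum E n t s x) < e"
    if "e > 0" and pt: "tagged_partition a b (e / 2) n t s" for e n t s
  proof -
    have "onorm (\<lambda>x. A x - rs_sum E n t s x) \<le> e / 2"
      using rs_sum_estimate[OF pt A cut] by (intro onorm_bound) (use \<open>e > 0\<close> in auto)
    then show ?thesis using \<open>e > 0\<close> by simp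
  qed
  then have "\<forall>e>0. \<exists>d>0. \<forall>n t s. tagged_partition a b d n t s \<longrightarrow>
      onorm (\<lambda>x. A x - rs_sum E n t s x) < e"
    by (metis half_gt_zero)
  then show ?thesis
    unfolding spectral_family_def tagged_partition_def rs_sum_def
    using proj mono right ab low high by blast
qed

text \<open>The integral is the limit of sums with mesh \<open>1 / (k + 1)\<close>. It inherits the
  cuts, with tolerance shrinking to \<open>0\<close>, and everything that commutes with the
  family.\<close>

lemma spectral_integral_exists:
  obtains A where "symmetric_op A" "\<And>l. spectral_cut A 0 (E l) l"
    and "\<And>U. bounded_linear U \<Longrightarrow> (\<And>l x. U (E l x) = E l (U x)) \<Longrightarrow> (\<And>x. U (A x) = A (U x))"
proof -
  have "\<exists>S. \<exists>n t s. tagged_partition a b (inverse (real (Suc k))) n t s \<and> S = rs_sum E n t s" for k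
  proof -
    have "inverse (real (Suc k)) > 0" by simp
    then obtain n t s where "tagged_partition a b (inverse (real (Suc k))) n t s"
      using tagged_partition_exists[OF ab] by blast
    then show ?thesis by blast
  qed
  then have "\<forall>k. \<exists>S. \<exists>n t s. tagged_partition a b (inverse (real (Suc k))) n t s \<and> S = rs_sum E n t s"
    by blast
  from choice[OF this] obtain S where "\<forall>k. \<exists>n t s. tagged_partition a b (inverse (real (Suc k))) n t s \<and> S k = rs_sum E n t s" ..
  then have S: "\<exists>n t s. tagged_partition a b (inverse (real (Suc k))) n t s \<and> S k = rs_sum E n t s" for k
    by blast
  have sym: "symmetric_op (S k)" for k using S[of k] symmetric_rs_sum by metis
  have cut: "spectral_cut (S k) (inverse (real (Suc k))) (E l) l" for k l
    using S[of k] spectral_cut_rs_sum by metis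
  \<comment> \<open>Each sum is itself an approximate cut for the whole family, so the estimate
    applies with \<open>S j\<close> in the role of \<open>A\<close>.\<close>
  have dist: "norm (S j x - S k x) \<le> (inverse (real (Suc k)) + inverse (real (Suc j))) * norm x" for j k x
    using S[of k] rs_sum_estimate[OF _ sym[of j] cut[of j]] by metis
  have "convergent (\<lambda>k. S k x)" for x
  proof (rule Cauchy_convergent, rule CauchyI)
    fix e :: real assume e: "e > 0"
    \<comment> \<open>The factor \<open>2\<close> accounts for the two meshes; the added
      \<open>1\<close> makes \<open>c\<close> positive and the final inequality strict even for
      \<open>x = 0\<close>.\<close>
    define c where "c = 2 * (norm x + 1)"
    have c: "c > 0" by (simp add: c_def add_nonneg_pos)
    obtain N where N: "inverse (real (Suc N)) < e / c"
      using reals_Archimedean[of "e / c"] e c by auto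
    have "norm (S j x - S k x) < e" if "j \<ge> N" "k \<ge> N" for j k
    proof -
      have "inverse (real (Suc k)) < e / c" "inverse (real (Suc j)) < e / c"
        using that N by (auto intro: order.strict_trans1[OF le_imp_inverse_le N])
      then have "(inverse (real (Suc k)) + inverse (real (Suc j))) * norm x \<le> (e / c + e / c) * norm x"
        by (intro mult_right_mono) auto
      also have "\<dots> < (e / c + e / c) * (norm x + 1)"
        using e c by (intro mult_strict_left_mono) auto
      also have "\<dots> = e / c * c" using c_def by (metis (no_types) mult.assoc mult.commute mult_2)
      also have "\<dots> = e" using c by simp
      finally show ?thesis using dist[of j x k] by linarith
    qed
    then show "\<exists>M. \<forall>m\<ge>M. \<forall>n\<ge>M. norm (S m x - S n x) < e" by blast
  qed
  then obtain A where lim: "\<And>x. (\<lambda>k. S k x) \<longlonglongrightarrow> A x" unfolding convergent_def by metis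
  have near: "norm (A x - S k x) \<le> inverse (real (Suc k)) * norm x" for x k
  proof (rule tendsto_le[OF sequentially_bot])
    show "(\<lambda>j. norm (S j x - S k x)) \<longlonglongrightarrow> norm (A x - S k x)" by (intro tendsto_intros lim)
    have "(\<lambda>j. (inverse (real (Suc k)) + inverse (real (Suc j))) * norm x)
        \<longlonglongrightarrow> (inverse (real (Suc k)) + 0) * norm x"
      by (intro tendsto_intros LIMSEQ_inverse_real_of_nat)
    then show "(\<lambda>j. (inverse (real (Suc k)) + inverse (real (Suc j))) * norm x)
        \<longlonglongrightarrow> inverse (real (Suc k)) * norm x" by simp
    show "\<forall>\<^sub>F j in sequentially. norm (S j x - S k x) \<le> (inverse (real (Suc k)) + inverse (real (Suc j))) * norm x"
      by (rule always_eventually) (intro allI dist)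
  qed
  interpret S0: bounded_linear "S 0" by (rule symmetric_op_linear[OF sym])
  obtain K where K: "\<And>x. norm (S 0 x) \<le> norm x * K" using S0.bounded by blast
  \<comment> \<open>\<open>K\<close> bounds \<open>S 0\<close>, and every other sum differs from it
    by at most \<open>1 + 1\<close>, both meshes being at most \<open>1\<close>.\<close>
  have "norm (S k x) \<le> (K + 2) * norm x" for k x
  proof -
    have "norm (S k x) \<le> norm (S 0 x) + norm (S k x - S 0 x)" by (rule norm_triangle_sub)
    also have "norm (S k x - S 0 x) \<le> (1 + 1) * norm x"
      by (rule dist[of k x 0, THEN order_trans], rule mult_right_mono) (auto simp: inverse_le_1_iff)
    finally show ?thesis using K[of x] by (simp add: algebra_simps)
  qed
  then have A: "symmetric_op A" by (rule symmetric_op_lim[OF sym lim])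
  moreover have "spectral_cut A 0 (E l) l" for l
  proof (rule spectral_cut_approx[OF proj symmetric_op_linear[OF A]])
    fix e :: real assume "e > 0"
    then obtain k where k: "inverse (real (Suc k)) < e" using reals_Archimedean by blast
    have "(l + inverse (real (Suc k))) * c \<le> (l + e) * c" "(l - e) * c \<le> (l - inverse (real (Suc k))) * c"
      if "c \<ge> 0" for c using that k by (simp_all add: mult_right_mono)
    then have "spectral_cut (S k) e (E l) l"
      using cut[of k l] unfolding spectral_cut_def by (meson order_trans zero_le_power2)
    moreover have "norm (A x - S k x) \<le> e * norm x" for x
      using near[of x k] k by (meson less_imp_le mult_right_mono norm_ge_zero order_trans)
    ultimately show "\<exists>S. spectral_cut S e (E l) l \<and> (\<forall>x. norm (A x - S x) \<le> e * norm x)" by blast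
  qed
  moreover have "U (A x) = A (U x)" if U: "bounded_linear U" "\<And>l x. U (E l x) = E l (U x)" for U x
  proof -
    have "U (S k x) = S k (U x)" for k using S[of k] rs_sum_commute[OF U] by metis
    moreover have "(\<lambda>k. U (S k x)) \<longlonglongrightarrow> U (A x)" by (rule bounded_linear.tendsto[OF U(1) lim])
    ultimately show ?thesis using lim[of "U x"] LIMSEQ_unique by simp
  qed
  ultimately show thesis using that by blast
qed

end

lemma spectral_family_resolution:
  assumes "spectral_family A E"
  obtains a b where "proj_resolution E a b"
    and "\<forall>e>0. \<exists>d>0. \<forall>n t s. tagged_partition a b d n t s \<longrightarrow>
      onorm (\<lambda>x. A x - rs_sum E n t s x) < e"
  using assms unfolding spectral_family_def proj_resolution_def tagged_partition_def rs_sum_def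
  by blast

lemma spectral_family_cut:
  assumes fam: "spectral_family A E" and A: "symmetric_op A"
  shows "spectral_cut A 0 (E l) l"
proof -
  obtain a b where "proj_resolution E a b"
    and lim: "\<forall>e>0. \<exists>d>0. \<forall>n t s. tagged_partition a b d n t s \<longrightarrow>
      onorm (\<lambda>x. A x - rs_sum E n t s x) < e"
    using spectral_family_resolution[OF fam] by blast
  interpret proj_resolution E a b by fact
  show ?thesis
  proof (rule spectral_cut_approx[OF proj symmetric_op_linear[OF A]])
    fix e :: real assume e: "e > 0"
    then obtain d where d: "d > 0" "\<And>n t s. tagged_partition a b d n t s \<Longrightarrow>
      onorm (\<lambda>x. A x - rs_sum E n t s x) < e" using lim by blast
    \<comment> \<open>One partition must be fine in two senses: mesh below \<open>d\<close> brings
      the sum close to \<open>A\<close>, mesh below \<open>e\<close> makes it a cut with tolerance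
      \<open>e\<close>.\<close>
    obtain n t s where pt: "tagged_partition a b (min d e) n t s"
      using tagged_partition_exists[OF ab, of "min d e"] d e by auto
    then have "tagged_partition a b d n t s" "tagged_partition a b e n t s"
      by (auto simp: tagged_partition_def)
    note small = d(2)[OF this(1)] and cut = spectral_cut_rs_sum[OF this(2)]
    have "norm (A x - rs_sum E n t s x) \<le> e * norm x" for x
    proof -
      have "bounded_linear (\<lambda>x. A x - rs_sum E n t s x)"
        by (intro symmetric_op_linear symmetric_op_diff A symmetric_rs_sum[OF pt])
      then have "norm (A x - rs_sum E n t s x) \<le> onorm (\<lambda>x. A x - rs_sum E n t s x) * norm x"
        by (rule onorm)
      also have "\<dots> \<le> e * norm x" using small by (intro mult_right_mono) auto
      finally show ?thesis .
    qed
    with cut show "\<exists>S. spectral_cut S e (E l) l \<and> (\<forall>x. norm (A x - S x) \<le> e * norm x)"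
      by blast
  qed
qed

section \<open>Intertwining and uniqueness of spectral families\<close>

text \<open>For \<open>T = A + c\<close> with \<open>c\<close> large, the powers of \<open>T\<close> grow at most like \<open>(l + c)^n\<close> on the
  range of \<open>P\<close> and at least like \<open>(m + c)^n\<close> on the kernel of \<open>Q\<close>; an operator commuting with \<open>T\<close>
  cannot connect the two.\<close>

lemma spectral_cut_intertwine:
  assumes A: "symmetric_op A" and P: "is_proj P" and Q: "is_proj Q"
    and cP: "spectral_cut A 0 P l" and cQ: "spectral_cut A 0 Q m" and lm: "l < m"
    and U: "bounded_linear U" and comm: "\<And>x. U (A x) = A (U x)"
  shows "Q (U (P x)) = U (P x)"
proof -
  obtain K where K: "K > 0" "\<And>x. norm (A x) \<le> norm x * K"
    using bounded_linear.pos_bounded[OF symmetric_op_linear[OF A]] by blast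
  obtain K' where K': "K' > 0" "\<And>x. norm (U x) \<le> norm x * K'"
    using bounded_linear.pos_bounded[OF U] by blast
  \<comment> \<open>This makes \<open>p\<close> positive and the form of \<open>T\<close>
    nonnegative, so that the upper bound on the range of \<open>P\<close> becomes a bound on the
    absolute value.\<close>
  define c where "c = K + \<bar>l\<bar> + 1"
  define p q where "p = l + c" and "q = m + c"
  have p: "p > 0" "q > p" "c - K \<ge> - p" using K(1) lm by (auto simp: p_def q_def c_def)
  define T where "T x = A x + c *\<^sub>R x" for x
  have T: "symmetric_op T"
    unfolding T_def[abs_def] by (intro symmetric_op_add A symmetric_op_scaleR symmetric_op_id)
  note linP = linear_simps[OF is_proj_linear[OF P]] and linQ = linear_simps[OF is_proj_linear[OF Q]]
    and linU = linear_simps[OF U] and linT = linear_simps[OF symmetric_op_linear[OF T]]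
  have TP: "T (P y) = P (T y)" for y using cP by (simp add: T_def linP spectral_cut_def)
  have TQ: "T (Q y) = Q (T y)" for y using cQ by (simp add: T_def linQ spectral_cut_def)
  have TU: "T (U y) = U (T y)" for y by (simp add: T_def linU comm)
  have up: "norm (T v) \<le> p * norm v" if v: "P v = v" for v
  proof (rule norm_le_of_form_bound[OF T, where M = "{v. P v = v}"])
    show "subspace {v. P v = v}" by (auto simp: subspace_def linP)
    show "T x \<in> {v. P v = v}" if "x \<in> {v. P v = v}" for x using that TP[of x] by simp
    fix x assume "x \<in> {v. P v = v}"
    then have "rin (A x) x \<le> l * (norm x)\<^sup>2" using cP by (simp add: spectral_cut_def)
    moreover have "\<bar>rin (A x) x\<bar> \<le> K * (norm x)\<^sup>2"
      using abs_rin_le_norm[of "A x" x] mult_right_mono[OF K(2)[of x] norm_ge_zero[of x]]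
      by (simp add: power2_eq_square mult_ac)
    moreover have "(c - K) * (norm x)\<^sup>2 \<ge> - p * (norm x)\<^sup>2" using p by (intro mult_right_mono) auto
    ultimately show "\<bar>rin (T x) x\<bar> \<le> p * (norm x)\<^sup>2"
      by (simp add: T_def rin_simps rin_self p_def algebra_simps abs_le_iff)
  qed (use v in simp)
  have lo: "q * norm w \<le> norm (T w)" if w: "Q w = 0" for w
  proof (cases "w = 0")
    case False
    have "m * (norm w)\<^sup>2 \<le> rin (A w) w" using cQ w by (simp add: spectral_cut_def)
    then have "q * (norm w)\<^sup>2 \<le> rin (T w) w"
      by (simp add: T_def rin_simps rin_self q_def algebra_simps)
    also have "\<dots> \<le> norm (T w) * norm w" by (rule rin_le_norm)
    finally show ?thesis using False by (simp add: power2_eq_square mult.assoc[symmetric])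
  qed simp
  \<comment> \<open>The component of \<open>U\<close> from the range of \<open>P\<close> into the
    kernel of \<open>Q\<close>. It commutes with \<open>T\<close>, so both growth rates apply to
    \<open>V ((T ^^ n) x)\<close>; as \<open>q > p\<close>, this forces
    \<open>V x = 0\<close>.\<close>
  define V where "V y = U (P y) - Q (U (P y))" for y
  have QV: "Q (V y) = 0" for y by (simp add: V_def linQ is_proj_idem[OF Q])
  have TV: "T (V y) = V (T y)" for y by (simp add: V_def linT TQ TU TP)
  have g1: "q ^ n * norm (V x) \<le> norm (V ((T ^^ n) x))" for n
  proof (induction n)
    case (Suc n)
    have "q ^ Suc n * norm (V x) \<le> q * norm (V ((T ^^ n) x))"
      using Suc p by (simp add: mult.assoc)
    also have "\<dots> \<le> norm (T (V ((T ^^ n) x)))" by (rule lo[OF QV])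
    finally show ?case by (simp add: TV)
  qed simp
  have g2: "norm (P ((T ^^ n) x)) \<le> p ^ n * norm (P x)" for n
  proof (induction n)
    case (Suc n)
    have "norm (P ((T ^^ Suc n) x)) = norm (T (P ((T ^^ n) x)))" by (simp add: TP)
    also have "\<dots> \<le> p * norm (P ((T ^^ n) x))" by (rule up[OF is_proj_idem[OF P]])
    also have "\<dots> \<le> p * (p ^ n * norm (P x))" using Suc p by simp
    finally show ?case by (simp add: mult.assoc)
  qed simp
  have "V x = 0"
  proof (rule ccontr)
    assume V0: "V x \<noteq> 0"
    obtain n where n: "K' * norm (P x) / norm (V x) < (q / p) ^ n"
      using real_arch_pow[of "q / p"] p by (metis less_divide_eq_1_pos)
    have "q ^ n * norm (V x) \<le> norm (U (P ((T ^^ n) x)))"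
      using g1[of n] is_proj_norm_le[OF is_proj_compl[OF Q], of "U (P ((T ^^ n) x))"]
      by (simp add: V_def)
    also have "\<dots> \<le> norm (P ((T ^^ n) x)) * K'" by (rule K'(2))
    also have "\<dots> \<le> p ^ n * norm (P x) * K'" using g2 K'(1) by (intro mult_right_mono) auto
    finally have "(q / p) ^ n \<le> K' * norm (P x) / norm (V x)"
      using V0 p by (simp add: power_divide field_simps)
    then show False using n by simp
  qed
  then show ?thesis by (simp add: V_def)
qed

text \<open>Squared distances within a monotone family of projections are differences of the
  monotone bounded quantity \<open>\<phi>\<close>, so the family is Cauchy along \<open>u\<close>.
  The limit is fixed by every \<open>E m\<close> with \<open>m > l\<close>, which identifies it as
  \<open>P x\<close>.\<close>

lemma proj_tendsto_inf:
  fixes E :: "real \<Rightarrow> 'a::chilbert_space \<Rightarrow> 'a"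
  assumes proj: "\<And>m. l < m \<Longrightarrow> is_proj (E m)"
    and mono: "\<And>m m'. l < m \<Longrightarrow> m \<le> m' \<Longrightarrow> proj_le (E m) (E m')"
    and P: "is_proj P" and inf: "\<And>x. P x = x \<longleftrightarrow> (\<forall>m>l. E m x = x)"
  shows "((\<lambda>m. E m x) \<longlongrightarrow> P x) (at_right l)"
proof -
  define u where "u n = l + inverse (real (Suc n))" for n
  have ul: "l < u n" for n by (simp add: u_def)
  have u_mono: "u j \<le> u i" if "i \<le> j" for i j using that by (simp add: u_def le_imp_inverse_le)
  define \<phi> where "\<phi> m = (norm (E m x))\<^sup>2" for m
  have diff: "(norm (E m' x - E m x))\<^sup>2 = \<phi> m' - \<phi> m" if "l < m" "m \<le> m'" for m m'
  proof -
    have m': "l < m'" using that by simp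
    have "(norm (E m' x - E m x))\<^sup>2 = rin (E m' x - E m x) x"
      using is_proj_rin_self[OF is_proj_diff[OF proj[OF that(1)] proj[OF m'] mono[OF that]]] by simp
    then show ?thesis by (simp add: rin_simps \<phi>_def is_proj_rin_self[OF proj] that m')
  qed
  have dec: "decseq (\<lambda>n. \<phi> (u n))"
    unfolding decseq_def
  proof (intro allI impI)
    fix i j :: nat assume "i \<le> j"
    then show "\<phi> (u j) \<le> \<phi> (u i)"
      using diff[OF ul u_mono, of i j] zero_le_power2[of "norm (E (u i) x - E (u j) x)"] by linarith
  qed
  obtain L where "(\<lambda>n. \<phi> (u n)) \<longlonglongrightarrow> L"
    using decseq_convergent[OF dec, of 0] by (auto simp: \<phi>_def)
  then have cau: "Cauchy (\<lambda>n. \<phi> (u n))" by (rule LIMSEQ_imp_Cauchy)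
  have "Cauchy (\<lambda>n. E (u n) x)"
  proof (rule CauchyI)
    fix e :: real assume e: "0 < e"
    obtain N where N: "\<And>i j. i \<ge> N \<Longrightarrow> j \<ge> N \<Longrightarrow> norm (\<phi> (u i) - \<phi> (u j)) < e\<^sup>2"
      using CauchyD[OF cau, of "e\<^sup>2"] e by auto
    have "norm (E (u i) x - E (u j) x) < e" if ij: "i \<ge> N" "j \<ge> N" for i j
    proof -
      have "(norm (E (u i) x - E (u j) x))\<^sup>2 = \<bar>\<phi> (u i) - \<phi> (u j)\<bar>"
      proof (cases "i \<le> j")
        case True
        then show ?thesis using diff[OF ul u_mono[OF True]]
          by (metis abs_of_nonneg zero_le_power2)
      next
        case False
        then have "j \<le> i" by simp
        from diff[OF ul u_mono[OF this]] show ?thesis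
          by (metis abs_minus_commute abs_of_nonneg norm_minus_commute zero_le_power2)
      qed
      then show ?thesis using N[OF ij] e by (simp add: power2_less_imp_less)
    qed
    then show "\<exists>M. \<forall>m\<ge>M. \<forall>n\<ge>M. norm (E (u m) x - E (u n) x) < e" by blast
  qed
  then obtain y where y: "(\<lambda>n. E (u n) x) \<longlonglongrightarrow> y" using Cauchy_convergent convergent_def by blast
  have u_lim: "u \<longlonglongrightarrow> l"
    unfolding u_def[abs_def] using tendsto_add[OF tendsto_const LIMSEQ_inverse_real_of_nat] by simp
  have "E m y = y" if m: "m > l" for m
  proof -
    have "(\<lambda>n. E m (E (u n) x)) \<longlonglongrightarrow> E m y" by (rule bounded_linear.tendsto[OF is_proj_linear[OF proj[OF m]] y])
    moreover have "\<forall>\<^sub>F n in sequentially. E m (E (u n) x) = E (u n) x"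
      using order_tendstoD(2)[OF u_lim m]
      by eventually_elim (metis proj_le_apply(1) mono less_imp_le ul proj m)
    ultimately have "(\<lambda>n. E (u n) x) \<longlonglongrightarrow> E m y" by (rule Lim_transform_eventually)
    then show ?thesis using y LIMSEQ_unique by blast
  qed
  then have Py: "P y = y" using inf by blast
  have "P x = y"
  proof -
    have "P (E (u n) x) = P x" for n
    proof -
      have "proj_le P (E (u n))" unfolding proj_le_iff[OF P proj[OF ul]]
        using inf is_proj_idem[OF P] ul by blast
      then show ?thesis using proj_le_apply(2)[OF _ P proj[OF ul]] by blast
    qed
    moreover have "(\<lambda>n. P (E (u n) x)) \<longlonglongrightarrow> P y" by (rule bounded_linear.tendsto[OF is_proj_linear[OF P] y])
    ultimately have "(\<lambda>n::nat. P x) \<longlonglongrightarrow> P y" by simp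
    then show ?thesis by (simp add: Py LIMSEQ_const_iff)
  qed
  note y = y[folded this]
  show ?thesis
  proof (rule tendstoI)
    fix e :: real assume e: "e > 0"
    obtain n where n: "norm (E (u n) x - P x) < e"
      using LIMSEQ_D[OF y e] by blast
    have "dist (E m x) (P x) < e" if m: "l < m" "m < u n" for m
    proof -
      have le: "proj_le P (E m)" unfolding proj_le_iff[OF P proj[OF m(1)]]
        using inf is_proj_idem[OF P] m by blast
      \<comment> \<open>\<open>E m\<close> is a contraction, which extends the estimate at the
        single point \<open>u n\<close> to all \<open>m\<close> between \<open>l\<close> and
        \<open>u n\<close>.\<close>
      have "E m x - P x = E m (E (u n) x - P x)"
        using proj_le_apply[OF mono[OF m(1)] proj[OF m(1)] proj[OF ul], of n x] m
          proj_le_apply(1)[OF le P proj[OF m(1)]]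
        by (simp add: linear_simps[OF is_proj_linear[OF proj[OF m(1)]]])
      then have "norm (E m x - P x) \<le> norm (E (u n) x - P x)"
        using is_proj_norm_le[OF proj[OF m(1)]] by metis
      then show ?thesis using n by (simp add: dist_norm)
    qed
    then show "\<forall>\<^sub>F m in at_right l. dist (E m x) (P x) < e"
      unfolding eventually_at_right_field using ul[of n] by blast
  qed
qed

lemma spectral_family_proj: "spectral_family A E \<Longrightarrow> is_proj (E l)"
  by (simp add: spectral_family_def)

text \<open>The strict gap between levels closes by right-continuity of \<open>F\<close>. With
  \<open>U\<close> the identity this compares two families of \<open>A\<close>; with
  \<open>E = F\<close> it yields commutation.\<close>

lemma spectral_family_intertwine:
  assumes A: "symmetric_op A" and E: "spectral_family A E" and F: "spectral_family A F"
    and U: "bounded_linear U" and comm: "\<And>x. U (A x) = A (U x)"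
  shows "F l (U (E l x)) = U (E l x)"
proof -
  have "F m (U (E l x)) = U (E l x)" if "l < m" for m
    by (rule spectral_cut_intertwine[OF A spectral_family_proj[OF E] spectral_family_proj[OF F]
          spectral_family_cut[OF E A] spectral_family_cut[OF F A] that U comm])
  then have "\<forall>\<^sub>F m in at_right l. F m (U (E l x)) = U (E l x)"
    using eventually_at_right_less by (rule eventually_mono[rotated])
  then have "((\<lambda>m. F m (U (E l x))) \<longlongrightarrow> U (E l x)) (at_right l)"
    by (rule tendsto_eventually)
  moreover have "((\<lambda>m. F m (U (E l x))) \<longlongrightarrow> F l (U (E l x))) (at_right l)"
    using F by (simp add: spectral_family_def)
  ultimately show ?thesis using tendsto_unique trivial_limit_at_right_real by blast
qed

lemma spectral_family_unique:
  assumes A: "symmetric_op A" and E: "spectral_family A E" and F: "spectral_family A F"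
  shows "E = F"
proof
  fix l
  have "proj_le (E l) (F l)" "proj_le (F l) (E l)"
    using spectral_family_intertwine[OF A E F bounded_linear_ident]
      spectral_family_intertwine[OF A F E bounded_linear_ident]
    by (simp_all add: proj_le_iff spectral_family_proj[OF E] spectral_family_proj[OF F])
  then show "E l = F l"
    by (rule proj_le_antisym[OF _ _ spectral_family_proj[OF E] spectral_family_proj[OF F]])
qed

lemma spec_fam_eq:
  assumes "symmetric_op A" "spectral_family A E"
  shows "spec_fam A = E"
  unfolding spec_fam_def using assms spectral_family_unique by (intro the_equality) blast+

lemma adj_commute:
  assumes A: "symmetric_op A" and U: "bounded_op U" and comm: "\<And>x. U (A x) = A (U x)"
  shows "adj U (A x) = A (adj U x)"
  by (rule rin_ext) (simp add: rin_adj[OF U] symmetric_op_rin[OF A] comm)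

lemma spectral_family_commute:
  assumes A: "symmetric_op A" and E: "spectral_family A E"
    and U: "bounded_op U" and comm: "\<And>x. U (A x) = A (U x)"
  shows "U (E l x) = E l (U x)"
proof (rule proj_commute_invariant[OF spectral_family_proj[OF E] U])
  fix x assume x: "E l x = x"
  show "E l (U x) = U x"
    using spectral_family_intertwine[OF A E E bounded_op_linear[OF U] comm, of l x] by (simp add: x)
  show "E l (adj U x) = adj U x"
    using spectral_family_intertwine[OF A E E bounded_op_linear[OF bounded_op_adj[OF U]]
        adj_commute[OF A U comm], of l x] by (simp add: x)
qed

section \<open>Square roots and the spectral theorem\<close>

text \<open>Polynomials in \<open>B\<close> with nonnegative coefficients, kept as operators.
  Products of such polynomials have nonnegative form by direct computation, whereas the usual proof
  that products of commuting positive operators are positive already uses square roots.\<close>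

inductive nonneg_poly :: "('a::chilbert_space \<Rightarrow> 'a) \<Rightarrow> ('a \<Rightarrow> 'a) \<Rightarrow> bool" for B where
  pow: "nonneg_poly B (B ^^ k)"
| add: "nonneg_poly B p \<Longrightarrow> nonneg_poly B q \<Longrightarrow> nonneg_poly B (\<lambda>x. p x + q x)"
| scale: "c \<ge> 0 \<Longrightarrow> nonneg_poly B p \<Longrightarrow> nonneg_poly B (\<lambda>x. c *\<^sub>R p x)"

lemma nonneg_poly_zero: "nonneg_poly B (\<lambda>x. 0)"
  using nonneg_poly.scale[OF order_refl nonneg_poly.pow[of B 0]] by simp

lemma nonneg_poly_self: "nonneg_poly B B"
  using nonneg_poly.pow[of B 1] by simp

lemma nonneg_poly_symmetric:
  assumes B: "symmetric_op B" and "nonneg_poly B p"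
  shows "symmetric_op p"
  using assms(2)
proof induction
  case (pow k)
  show ?case
  proof (induction k)
    case 0 show ?case using symmetric_op_id by (simp add: id_def)
  next
    case (Suc k)
    show ?case using symmetric_op_commuting_comp[OF B Suc] by (simp add: funpow_swap1 comp_def)
  qed
qed (auto intro: symmetric_op_add symmetric_op_scaleR)

lemma nonneg_poly_commute:
  assumes U: "bounded_linear U" and comm: "\<And>x. U (B x) = B (U x)" and "nonneg_poly B p"
  shows "U (p x) = p (U x)"
  using assms(3)
proof (induction arbitrary: x)
  case (pow k)
  show ?case by (induction k) (simp_all add: comm)
qed (simp_all add: linear_simps[OF U])

lemma nonneg_poly_comp:
  assumes B: "symmetric_op B" and p: "nonneg_poly B p" and q: "nonneg_poly B q"
  shows "nonneg_poly B (\<lambda>x. p (q x))"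
  using p
proof induction
  case (pow k)
  note lin = linear_simps[OF symmetric_op_linear[OF nonneg_poly_symmetric[OF B nonneg_poly.pow[of B k]]]]
  show ?case using q
  proof induction
    case (pow j)
    have "nonneg_poly B (B ^^ (k + j))" by (rule nonneg_poly.pow)
    then show ?case by (simp add: funpow_add comp_def)
  qed (simp_all add: lin nonneg_poly.add nonneg_poly.scale)
qed (simp_all add: nonneg_poly.add nonneg_poly.scale)

text \<open>Two factors at a time are shared between the arguments of \<open>rin\<close>, so powers
  reduce to the exponents \<open>0\<close> and \<open>1\<close>.\<close>

lemma nonneg_poly_form_nonneg:
  assumes B: "symmetric_op B" and pos: "\<And>x. rin (B x) x \<ge> 0" and "nonneg_poly B p"
  shows "rin (p x) x \<ge> 0"
  using assms(3)
proof induction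
  case (pow k)
  show ?case
  proof (induction k arbitrary: x rule: induct_nat_012)
    case (ge2 n)
    have "rin ((B ^^ Suc (Suc n)) x) x = rin ((B ^^ n) (B x)) (B x)"
      using symmetric_op_rin[OF B, of "(B ^^ n) (B x)" x] by (simp add: funpow_swap1)
    then show ?case using ge2 by simp
  qed (simp_all add: rin_self pos)
qed (simp_all add: rin_simps)

primrec sqrt_iter :: "('a::chilbert_space \<Rightarrow> 'a) \<Rightarrow> nat \<Rightarrow> 'a \<Rightarrow> 'a" where
  "sqrt_iter B 0 = (\<lambda>x. 0)"
| "sqrt_iter B (Suc n) = (\<lambda>x. (1/2) *\<^sub>R (B x + sqrt_iter B n (sqrt_iter B n x)))"

text \<open>With \<open>B = 1 - C\<close>, the iterates increase to a solution of \<open>Y = (B + Y\<^sup>2) / 2\<close>, that is of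
  \<open>(1 - Y)\<^sup>2 = C\<close>. Monotonicity holds because the increments are polynomials in \<open>B\<close> with
  nonnegative coefficients.\<close>

lemma nonneg_sqrt_exists:
  fixes C :: "'a::chilbert_space \<Rightarrow> 'a"
  assumes C: "symmetric_op C" and C0: "\<And>x. rin (C x) x \<ge> 0" and C1: "\<And>x. rin (C x) x \<le> (norm x)\<^sup>2"
  obtains Q where "symmetric_op Q" "\<And>x. rin (Q x) x \<ge> 0" "\<And>x. Q (Q x) = C x"
    "\<And>U x. bounded_linear U \<Longrightarrow> (\<And>x. U (C x) = C (U x)) \<Longrightarrow> U (Q x) = Q (U x)"
proof -
  define B where "B x = x - C x" for x
  define Y where "Y = sqrt_iter B"
  have B: "symmetric_op B" unfolding B_def[abs_def] by (intro symmetric_op_diff symmetric_op_id C)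
  have B0: "rin (B x) x \<ge> 0" for x using C1 by (simp add: B_def rin_simps rin_self)
  \<comment> \<open>Both bounds on \<open>C\<close> enter: they place the form of \<open>B\<close>
    between \<open>0\<close> and \<open>1\<close> times the squared norm.\<close>
  have Bn: "norm (B x) \<le> norm x" for x
  proof -
    have "\<bar>rin (B x) x\<bar> \<le> 1 * (norm x)\<^sup>2" for x
      using B0[of x] C0[of x] by (simp add: B_def rin_simps rin_self)
    then show ?thesis using norm_le_of_form_bound[OF B, of UNIV 1 x] by simp
  qed
  have Ypoly: "nonneg_poly B (Y n)" for n
    by (induction n) (simp_all add: Y_def nonneg_poly_zero nonneg_poly.scale nonneg_poly.add
        nonneg_poly_self nonneg_poly_comp[OF B])
  note Ysym = nonneg_poly_symmetric[OF B Ypoly]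
  note Ylin = linear_simps[OF symmetric_op_linear[OF Ysym]]
  have Ycomm: "U (Y n x) = Y n (U x)" if "bounded_linear U" "\<And>x. U (B x) = B (U x)" for U n x
    by (rule nonneg_poly_commute[OF that Ypoly])
  have YB: "Y n (B x) = B (Y n x)" for n x
    using nonneg_poly_commute[OF symmetric_op_linear[OF B] _ Ypoly] by simp
  have YY: "Y m (Y n x) = Y n (Y m x)" for m n x
    by (rule Ycomm[OF symmetric_op_linear[OF Ysym] YB])
  have Y_Suc: "Y (Suc n) x = (1/2) *\<^sub>R (B x + Y n (Y n x))" for n x by (simp add: Y_def)
  have step: "nonneg_poly B (\<lambda>x. Y (Suc n) x - Y n x)" for n
  proof (induction n)
    case 0
    show ?case by (simp add: Y_def nonneg_poly.scale nonneg_poly_self)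
  next
    case (Suc n)
    \<comment> \<open>The next increment is half the product of the previous increment with the sum
      of the two iterates, because iterates commute.\<close>
    have "nonneg_poly B (\<lambda>x. (1/2) *\<^sub>R ((\<lambda>y. Y (Suc n) y - Y n y) (Y (Suc n) x + Y n x)))"
      by (rule nonneg_poly.scale[OF _ nonneg_poly_comp[OF B Suc nonneg_poly.add[OF Ypoly Ypoly]]]) simp
    moreover have "(1/2) *\<^sub>R ((\<lambda>y. Y (Suc n) y - Y n y) (Y (Suc n) x + Y n x))
        = Y (Suc (Suc n)) x - Y (Suc n) x" for x
      unfolding Y_Suc[of "Suc n"] Y_Suc[of n x]
      by (simp add: Ylin YY[of n "Suc n"] flip: scaleR_diff_right) (simp add: Y_Suc[of n] Ylin YB)
    ultimately show ?case by simp
  qed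
  have mono: "nonneg_poly B (\<lambda>x. Y m x - Y n x)" if "n \<le> m" for m n
    using that
  proof (induction m rule: dec_induct)
    case (step m)
    show ?case using nonneg_poly.add[OF \<open>nonneg_poly B (\<lambda>x. Y (Suc m) x - Y m x)\<close> step.IH] by simp
  qed (simp add: nonneg_poly_zero)
  have Yn: "norm (Y n x) \<le> norm x" for n x
  proof (induction n arbitrary: x)
    case (Suc n)
    have "norm (B x + Y n (Y n x)) \<le> norm x + norm x"
      using Bn[of x] Suc[of x] Suc[of "Y n x"] norm_triangle_ineq[of "B x" "Y n (Y n x)"] by linarith
    then show ?case by (simp add: Y_Suc)
  qed (simp add: Y_def)
  have key: "(norm (Y m x - Y n x))\<^sup>2 \<le> 2 * (rin (Y m x) x - rin (Y n x) x)" if "n \<le> m" for m n x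
  proof -
    define D where "D x = Y m x - Y n x" for x
    have pD: "nonneg_poly B D" unfolding D_def[abs_def] by (rule mono[OF that])
    have D: "symmetric_op D" by (rule nonneg_poly_symmetric[OF B pD])
    have D0: "rin (D x) x \<ge> 0" for x by (rule nonneg_poly_form_nonneg[OF B B0 pD])
    note lin = linear_simps[OF symmetric_op_linear[OF D]]
    have Dn: "norm (D x) \<le> 2 * norm x" for x
      using norm_triangle_ineq4[of "Y m x" "Y n x"] Yn[of m x] Yn[of n x] by (simp add: D_def)
    have "rin (D (D x)) (D x) \<le> norm (D (D x)) * norm (D x)" by (rule rin_le_norm)
    also have "\<dots> \<le> 2 * norm (D x) * norm (D x)" by (intro mult_right_mono Dn) simp
    finally have "rin (D (D x)) (D x) \<le> 2 * (norm (D x))\<^sup>2" by (simp add: power2_eq_square)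
    \<comment> \<open>Testing nonnegativity at this vector, with
      \<open>norm (D x) \<le> 2 * norm x\<close>, bounds the squared norm of \<open>D x\<close> by
      its form. Monotone convergence of the forms thus becomes strong convergence.\<close>
    moreover have "rin (D (x - (1/2) *\<^sub>R D x)) (x - (1/2) *\<^sub>R D x)
        = rin (D x) x - (norm (D x))\<^sup>2 + rin (D (D x)) (D x) / 4"
      using symmetric_op_rin[OF D, of "D x" x] by (simp add: lin rin_simps rin_self field_simps)
    ultimately have "(norm (D x))\<^sup>2 \<le> 2 * rin (D x) x"
      using D0[of "x - (1/2) *\<^sub>R D x"] by simp
    then show ?thesis by (simp add: D_def rin_simps)
  qed
  have "convergent (\<lambda>n. Y n x)" for x
  proof (rule Cauchy_convergent, rule CauchyI)
    fix e :: real assume e: "e > 0"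
    have inc: "incseq (\<lambda>n. rin (Y n x) x)" unfolding incseq_def
    proof (intro allI impI)
      fix n m :: nat assume "n \<le> m"
      from order_trans[OF zero_le_power2 key[OF this, of x]]
      show "rin (Y n x) x \<le> rin (Y m x) x" by simp
    qed
    have "rin (Y n x) x \<le> (norm x)\<^sup>2" for n
      using rin_le_norm[of "Y n x" x] mult_right_mono[OF Yn[of n x] norm_ge_zero[of x]]
      by (simp add: power2_eq_square)
    then obtain L where "(\<lambda>n. rin (Y n x) x) \<longlonglongrightarrow> L"
      using incseq_convergent[OF inc] by blast
    then have "Cauchy (\<lambda>n. rin (Y n x) x)" by (rule LIMSEQ_imp_Cauchy)
    then obtain N where N: "\<And>m n. m \<ge> N \<Longrightarrow> n \<ge> N \<Longrightarrow> norm (rin (Y m x) x - rin (Y n x) x) < e\<^sup>2 / 2"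
      using CauchyD[of "\<lambda>n. rin (Y n x) x" "e\<^sup>2 / 2"] e by auto
    have *: "norm (Y m x - Y n x) < e" if "n \<le> m" "m \<ge> N" "n \<ge> N" for m n
    proof -
      have "(norm (Y m x - Y n x))\<^sup>2 \<le> 2 * \<bar>rin (Y m x) x - rin (Y n x) x\<bar>"
        by (rule key[OF that(1), THEN order_trans]) (intro mult_left_mono abs_ge_self, simp)
      also have "\<dots> < e\<^sup>2" using N[OF that(2,3)] by simp
      finally have "(norm (Y m x - Y n x))\<^sup>2 < e\<^sup>2" .
      then show ?thesis using e by (simp add: power2_less_imp_less)
    qed
    have "norm (Y m x - Y n x) < e" if "m \<ge> N" "n \<ge> N" for m n
      using *[of n m] *[of m n] that by (cases "n \<le> m") (simp_all add: norm_minus_commute)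
    then show "\<exists>M. \<forall>m\<ge>M. \<forall>n\<ge>M. norm (Y m x - Y n x) < e" by blast
  qed
  then obtain Z where lim: "\<And>x. (\<lambda>n. Y n x) \<longlonglongrightarrow> Z x" unfolding convergent_def by metis
  have Z: "symmetric_op Z" by (rule symmetric_op_lim[OF Ysym lim, of 1]) (simp add: Yn)
  have Zn: "norm (Z x) \<le> norm x" for x
    using LIMSEQ_le_const2[OF tendsto_norm[OF lim]] Yn by blast
  have Zeq: "Z x = (1/2) *\<^sub>R (B x + Z (Z x))" for x
  proof -
    \<comment> \<open>Both operator and argument vary with \<open>n\<close>; the common bound on the
      \<open>Y n\<close> separates the two limits.\<close>
    have "(\<lambda>n. Y n (Y n x - Z x)) \<longlonglongrightarrow> 0"
    proof (rule tendsto_norm_zero_cancel, rule tendsto_sandwich[OF _ _ tendsto_const])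
      show "\<forall>\<^sub>F n in sequentially. norm (Y n (Y n x - Z x)) \<le> norm (Y n x - Z x)" by (simp add: Yn)
      have "(\<lambda>n. Y n x - Z x) \<longlonglongrightarrow> Z x - Z x" by (intro tendsto_intros lim)
      then show "(\<lambda>n. norm (Y n x - Z x)) \<longlonglongrightarrow> 0" by (simp add: tendsto_norm_zero)
    qed simp
    then have "(\<lambda>n. Y n (Y n x - Z x) + Y n (Z x)) \<longlonglongrightarrow> 0 + Z (Z x)"
      by (intro tendsto_add lim)
    then have "(\<lambda>n. Y n (Y n x)) \<longlonglongrightarrow> Z (Z x)" by (simp add: Ylin)
    then have "(\<lambda>n. Y (Suc n) x) \<longlonglongrightarrow> (1/2) *\<^sub>R (B x + Z (Z x))"
      unfolding Y_Suc by (intro tendsto_intros)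
    then show ?thesis using LIMSEQ_Suc[OF lim] LIMSEQ_unique by blast
  qed
  \<comment> \<open>Expanding the square gives the identity minus \<open>2 *\<^sub>R Z x\<close>
    plus \<open>Z (Z x)\<close>, and the fixed-point equation leaves \<open>x - B x\<close>, which
    is \<open>C x\<close>.\<close>
  define Q where "Q x = x - Z x" for x
  have "symmetric_op Q" unfolding Q_def[abs_def] by (intro symmetric_op_diff symmetric_op_id Z)
  moreover have "rin (Q x) x \<ge> 0" for x
    using rin_le_norm[of "Z x" x] mult_right_mono[OF Zn[of x] norm_ge_zero[of x]]
    by (simp add: Q_def rin_simps rin_self power2_eq_square)
  moreover have "Q (Q x) = C x" for x
  proof -
    have "2 *\<^sub>R Z x = 2 *\<^sub>R ((1/2) *\<^sub>R (B x + Z (Z x)))" using Zeq[of x] by simp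
    then have "Z x + Z x = B x + Z (Z x)" by (simp add: scaleR_2)
    then show ?thesis
      by (simp add: Q_def linear_simps[OF symmetric_op_linear[OF Z]] B_def algebra_simps)
  qed
  moreover have "U (Q x) = Q (U x)" if U: "bounded_linear U" "\<And>x. U (C x) = C (U x)" for U x
  proof -
    have "U (B x) = B (U x)" for x by (simp add: B_def linear_simps[OF U(1)] U(2))
    then have "U (Y n x) = Y n (U x)" for n by (rule Ycomm[OF U(1)])
    moreover have "(\<lambda>n. U (Y n x)) \<longlonglongrightarrow> U (Z x)" by (rule bounded_linear.tendsto[OF U(1) lim])
    ultimately have "U (Z x) = Z (U x)" using lim[of "U x"] LIMSEQ_unique by simp
    then show ?thesis by (simp add: Q_def linear_simps[OF U(1)])
  qed
  ultimately show thesis using that by blast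
qed

section \<open>Construction of cuts and of the spectral family\<close>

lemma symmetric_op_proj_commute:
  assumes S: "symmetric_op S" and P: "is_proj P" and inv: "\<And>x. P x = x \<Longrightarrow> P (S x) = S x"
  shows "S (P x) = P (S x)"
proof (rule proj_commute_invariant[OF P])
  show "bounded_op S" using S by (simp add: symmetric_op_def)
  show "P (adj S x) = adj S x" if "P x = x" for x
    using inv[OF that] S by (simp only: symmetric_op_iff_adj)
qed (rule inv)

text \<open>The cut at \<open>0\<close> is the projection onto the kernel of \<open>\<bar>T\<bar> + T\<close>, where \<open>\<bar>T\<bar> = sqrt (T\<^sup>2)\<close>.\<close>

lemma spectral_cut_zero_exists:
  assumes S: "symmetric_op S"
  obtains P where "is_proj P" "spectral_cut S 0 P 0"
proof -
  obtain K where K: "K > 0" "\<And>x. norm (S x) \<le> norm x * K"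
    using bounded_linear.pos_bounded[OF symmetric_op_linear[OF S]] by blast
  \<comment> \<open>Scaling brings the square of the operator below the identity, as the square root
    construction requires.\<close>
  define T where "T x = (1 / K) *\<^sub>R S x" for x
  have T: "symmetric_op T" unfolding T_def[abs_def] by (rule symmetric_op_scaleR[OF S])
  have ST: "S x = K *\<^sub>R T x" for x using K(1) by (simp add: T_def)
  have Tn: "norm (T x) \<le> norm x" for x using K by (simp add: T_def field_simps)
  have C: "symmetric_op (\<lambda>x. T (T x))" by (rule symmetric_op_commuting_comp[OF T T]) simp
  have form: "rin (T (T x)) x = (norm (T x))\<^sup>2" for x by (simp add: symmetric_op_rin[OF T] rin_self)
  obtain Q where Q: "symmetric_op Q" "\<And>x. rin (Q x) x \<ge> 0" "\<And>x. Q (Q x) = T (T x)"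
    and comm: "\<And>U x. bounded_linear U \<Longrightarrow> (\<And>x. U (T (T x)) = T (T (U x))) \<Longrightarrow> U (Q x) = Q (U x)"
    using nonneg_sqrt_exists[OF C] form Tn by (metis (no_types, lifting) norm_ge_zero power_mono zero_le_power2)
  have TQ: "T (Q x) = Q (T x)" for x by (rule comm[OF symmetric_op_linear[OF T]]) simp
  note linT = linear_simps[OF symmetric_op_linear[OF T]] and linQ = linear_simps[OF symmetric_op_linear[OF Q(1)]]
  define M where "M = {x. Q x + T x = 0}"
  have "closed M" unfolding M_def
    by (intro closed_Collect_eq continuous_intros linear_continuous_on symmetric_op_linear Q(1) T)
  moreover have "subspace M"
    by (auto simp: M_def subspace_def linT linQ add_eq_0_iff2 add.commute scaleR_right_distrib[symmetric])
  moreover have "cscale c x \<in> M" if "x \<in> M" for c x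
    using that by (simp add: M_def symmetric_op_cscale[OF T] symmetric_op_cscale[OF Q(1)]
        linear_simps[OF bounded_linear_cscale] flip: cscale_add_right)
  ultimately obtain P where P: "is_proj P" "range P = M" using proj_exists by metis
  have PM: "P x = x \<longleftrightarrow> Q x + T x = 0" for x
    using is_proj_range[OF P(1)] P(2) by (simp add: M_def)
  have inv: "P (S x) = S x" if x: "P x = x" for x
  proof -
    have "Q (S x) + T (S x) = K *\<^sub>R T (Q x + T x)"
      by (simp add: ST linT linQ TQ scaleR_right_distrib)
    also have "\<dots> = 0" using x by (simp only: PM linT(3) scaleR_zero_right)
    finally show ?thesis by (simp only: PM)
  qed
  have "S (P x) = P (S x)" for x
    by (rule symmetric_op_proj_commute[OF S P(1) inv])
  moreover have "rin (S x) x \<le> 0" if "P x = x" for x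
  proof -
    have "T x = - Q x" using that by (simp add: PM add_eq_0_iff)
    then show ?thesis using K(1) Q(2)[of x] by (simp add: ST rin_simps rin.minus_left)
  qed
  moreover have "rin (S x) x \<ge> 0" if x: "P x = 0" for x
  proof -
    have "T x = Q x"
    proof (rule rin_ext)
      fix y
      \<comment> \<open>The sum \<open>Q + T\<close> annihilates \<open>Q - T\<close> since the
        squares of \<open>Q\<close> and \<open>T\<close> agree; hence \<open>Q - T\<close> maps into
        \<open>M\<close>, to which \<open>x\<close> is orthogonal.\<close>
      have "P (Q y - T y) = Q y - T y" unfolding PM by (simp add: linT linQ TQ Q(3))
      then have "rin x (Q y - T y) = 0" using x is_proj_rin[OF P(1), of x "Q y - T y"] by simp
      then show "rin (T x) y = rin (Q x) y"
        by (simp add: symmetric_op_rin[OF T] symmetric_op_rin[OF Q(1)] rin_simps)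
    qed
    then show ?thesis using K(1) Q(2)[of x] by (simp add: ST rin_simps)
  qed
  ultimately have "spectral_cut S 0 P 0" by (simp add: spectral_cut_def)
  then show thesis using that P by blast
qed

lemma spectral_cut_exists:
  assumes A: "symmetric_op A"
  obtains P where "is_proj P" "spectral_cut A 0 P l"
proof -
  have "symmetric_op (\<lambda>x. A x - l *\<^sub>R x)"
    by (intro symmetric_op_diff symmetric_op_scaleR symmetric_op_id A)
  then obtain P where P: "is_proj P" "spectral_cut (\<lambda>x. A x - l *\<^sub>R x) 0 P 0"
    using spectral_cut_zero_exists by blast
  then have "spectral_cut A 0 P l"
    by (simp add: spectral_cut_def linear_simps[OF is_proj_linear[OF P(1)]] rin_simps rin_self)
  then show thesis using that P by blast
qed

text \<open>Arbitrary cuts \<open>G l\<close> are monotone but may jump on the wrong side. Taking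
  the infimum over all \<open>m > l\<close> makes them right-continuous, and the cut property
  survives the limit.\<close>

theorem spectral_family_exists:
  fixes A :: "'a::chilbert_space \<Rightarrow> 'a"
  assumes A: "symmetric_op A"
  obtains E where "spectral_family A E"
proof -
  have "\<forall>l. \<exists>P. is_proj P \<and> spectral_cut A 0 P l"
    using spectral_cut_exists[OF A] by blast
  from choice[OF this] obtain G where Gp: "\<And>l. is_proj (G l)" and Gc: "\<And>l. spectral_cut A 0 (G l) l"
    by blast
  obtain K where K: "K > 0" "\<And>x. norm (A x) \<le> norm x * K"
    using bounded_linear.pos_bounded[OF symmetric_op_linear[OF A]] by blast
  have form: "\<bar>rin (A x) x\<bar> \<le> K * (norm x)\<^sup>2" for x
    using abs_rin_le_norm[of "A x" x] mult_right_mono[OF K(2)[of x] norm_ge_zero[of x]]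
    by (simp add: power2_eq_square mult_ac)
  have Gm: "proj_le (G l) (G m)" if "l \<le> m" for l m
  proof (cases "l = m")
    case False
    then show ?thesis
      using that spectral_cut_intertwine[OF A Gp Gp Gc Gc _ bounded_linear_ident, of l m]
      by (simp add: proj_le_iff Gp)
  qed (simp add: proj_le_refl Gp)
  have "\<exists>P. is_proj P \<and> (\<forall>x. P x = x \<longleftrightarrow> (\<forall>m\<in>{l<..}. G m x = x))" for l
    using proj_exists_INT[of "{l<..}" G] Gp by metis
  then obtain E where Ep: "\<And>l. is_proj (E l)"
    and EG: "\<And>l x. E l x = x \<longleftrightarrow> (\<forall>m>l. G m x = x)" by (metis greaterThan_iff)
  have Em: "proj_le (E l) (E m)" if "l \<le> m" for l m
    unfolding proj_le_iff[OF Ep Ep]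
  proof
    fix x
    have "E l (E l x) = E l x" by (rule is_proj_idem[OF Ep])
    then show "E m (E l x) = E l x" using that unfolding EG by fastforce
  qed
  have G_lim: "((\<lambda>m. G m x) \<longlongrightarrow> E l x) (at_right l)" for l x
    by (rule proj_tendsto_inf[OF Gp Gm Ep EG])
  have right: "((\<lambda>m. E m x) \<longlongrightarrow> E l x) (at_right l)" for l x
  proof (rule proj_tendsto_inf[OF Ep Em Ep])
    fix x
    show "E l x = x \<longleftrightarrow> (\<forall>m>l. E m x = x)"
    proof
      assume R: "\<forall>m>l. E m x = x"
      \<comment> \<open>The midpoint leaves room on both sides: \<open>E\<close> there is assumed to
        fix \<open>x\<close>, and it lies below \<open>G m\<close>.\<close>
      have "G m x = x" if "m > l" for m
        using R[rule_format, of "(l + m) / 2"] that EG[of "(l + m) / 2" x] by simp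
      then show "E l x = x" using EG by blast
    qed (use EG in fastforce)
  qed
  have up: "rin (A x) x \<le> l * (norm x)\<^sup>2" if "E l x = x" for l x
  proof (rule le_of_forall_pos_mult)
    fix e :: real assume "e > 0"
    then have "G (l + e) x = x" using that EG by simp
    then have "rin (A x) x \<le> (l + e) * (norm x)\<^sup>2" using Gc[of "l + e"] by (simp add: spectral_cut_def)
    then show "rin (A x) x \<le> l * (norm x)\<^sup>2 + e * (norm x)\<^sup>2" by (simp add: algebra_simps)
  qed
  \<comment> \<open>A vector killed by \<open>E l\<close> need not be killed by any
    \<open>G m\<close> with \<open>m > l\<close>. Its components \<open>x - G m x\<close> are, and
    they tend to \<open>x\<close>.\<close>
  have lo: "l * (norm x)\<^sup>2 \<le> rin (A x) x" if "E l x = 0" for l x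
  proof (rule tendsto_le[OF trivial_limit_at_right_real])
    have L: "((\<lambda>m. x - G m x) \<longlongrightarrow> x) (at_right l)"
      using tendsto_diff[OF tendsto_const G_lim, of x x l] that by simp
    show "((\<lambda>m. m * (norm (x - G m x))\<^sup>2) \<longlongrightarrow> l * (norm x)\<^sup>2) (at_right l)"
      by (intro tendsto_mult tendsto_power tendsto_norm L tendsto_ident_at)
    show "((\<lambda>m. rin (A (x - G m x)) (x - G m x)) \<longlongrightarrow> rin (A x) x) (at_right l)"
      by (intro rin.tendsto bounded_linear.tendsto[OF symmetric_op_linear[OF A]] L)
    have "m * (norm (x - G m x))\<^sup>2 \<le> rin (A (x - G m x)) (x - G m x)" for m
      using Gc[of m] by (simp add: spectral_cut_def linear_simps[OF is_proj_linear[OF Gp]] is_proj_idem[OF Gp])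
    then show "\<forall>\<^sub>F m in at_right l. m * (norm (x - G m x))\<^sup>2 \<le> rin (A (x - G m x)) (x - G m x)"
      by simp
  qed
  have inv: "E l (A x) = A x" if "E l x = x" for l x
    using that Gc unfolding EG spectral_cut_def by metis
  have comm: "A (E l x) = E l (A x)" for l x
    by (rule symmetric_op_proj_commute[OF A Ep inv])
  have cut: "spectral_cut A 0 (E l) l" for l using comm up lo by (simp add: spectral_cut_def)
  \<comment> \<open>The form of \<open>A\<close> stays between \<open>-K\<close> and
    \<open>K\<close>; the extra \<open>1\<close> gives a contradiction on nonzero vectors, endpoints
    included.\<close>
  interpret proj_resolution E "- K - 1" "K + 1"
  proof
    show "- K - 1 < K + 1" using K(1) by simp
    fix l :: real
    show "E l = (\<lambda>x. 0)" if l: "l \<le> - K - 1"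
    proof
      fix x
      define y where "y = E l x"
      have "rin (A y) y \<le> l * (norm y)\<^sup>2" by (rule up) (simp add: y_def is_proj_idem[OF Ep])
      also have "\<dots> \<le> (- K - 1) * (norm y)\<^sup>2" using l by (intro mult_right_mono) auto
      finally have "(norm y)\<^sup>2 \<le> 0"
        using form[of y] unfolding abs_le_iff left_diff_distrib distrib_right by linarith
      then show "E l x = 0" by (simp add: y_def)
    qed
    show "E l = id" if l: "K + 1 \<le> l"
    proof
      fix x
      define y where "y = x - E l x"
      have "(K + 1) * (norm y)\<^sup>2 \<le> l * (norm y)\<^sup>2" using l by (intro mult_right_mono) auto
      also have "\<dots> \<le> rin (A y) y"
        by (rule lo) (simp add: y_def linear_simps[OF is_proj_linear[OF Ep]] is_proj_idem[OF Ep])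
      finally have "(norm y)\<^sup>2 \<le> 0"
        using form[of y] unfolding abs_le_iff left_diff_distrib distrib_right by linarith
      then show "E l x = id x" by (simp add: y_def)
    qed
  qed (use Ep Em in auto)
  show thesis using that spectral_familyI[OF right A cut] by blast
qed

section \<open>The projection lattice of a von Neumann algebra\<close>

lemma von_neumann_memI:
  assumes "von_neumann_algebra R" "bounded_op T"
    and "\<And>U x. U \<in> commutant R \<Longrightarrow> U (T x) = T (U x)"
  shows "T \<in> R"
proof -
  have "T \<in> commutant (commutant R)"
    using assms(2,3) by (auto simp: commutant_def[of "commutant R"] fun_eq_iff)
  then show ?thesis using assms(1) by (simp add: von_neumann_algebra_def)
qed

lemma commutant_commute: "U \<in> commutant R \<Longrightarrow> T \<in> R \<Longrightarrow> U (T x) = T (U x)"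
  by (auto simp: commutant_def fun_eq_iff)

lemma commutant_bounded_op: "U \<in> commutant R \<Longrightarrow> bounded_op U"
  by (simp add: commutant_def)

lemma von_neumann_bounded_op: "von_neumann_algebra R \<Longrightarrow> T \<in> R \<Longrightarrow> bounded_op T"
  by (auto simp: von_neumann_algebra_def)

text \<open>Supplies the invariance under adjoints that \<open>proj_commute_invariant\<close> asks
  for.\<close>

lemma commutant_adj:
  assumes R: "von_neumann_algebra R" and U: "U \<in> commutant R"
  shows "adj U \<in> commutant R"
proof -
  have "adj U (T x) = T (adj U x)" if T: "T \<in> R" for T x
  proof (rule rin_ext)
    fix y
    note bT = von_neumann_bounded_op[OF R T] and bU = commutant_bounded_op[OF U]
    have aT: "adj T \<in> R" using R T by (simp add: von_neumann_algebra_def)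
    have "rin (adj U (T x)) y = rin (adj T (U y)) x" by (simp only: rin_adj[OF bU] rin_adj[OF bT] rin_commute[of "T x"])
    also have "\<dots> = rin x (U (adj T y))" by (simp only: commutant_commute[OF U aT] rin_commute)
    also have "\<dots> = rin (adj T y) (adj U x)" by (simp only: rin_adj[OF bU, symmetric] rin_commute[of "adj U x"])
    also have "\<dots> = rin (T (adj U x)) y" by (simp only: rin_adj[OF bT] rin_commute[of y])
    finally show "rin (adj U (T x)) y = rin (T (adj U x)) y" .
  qed
  then show ?thesis
    using bounded_op_adj[OF commutant_bounded_op[OF U]] by (auto simp: commutant_def)
qed

lemma projections_is_proj: "P \<in> projections R \<Longrightarrow> is_proj P"
  by (simp add: projections_def)

text \<open>The common fixed space is invariant under the commutant and its adjoints, so the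
  projection onto it commutes with the commutant and lies in the bicommutant.\<close>

lemma projections_INT:
  assumes R: "von_neumann_algebra R" and S: "S \<subseteq> projections R"
  obtains P where "P \<in> projections R" "\<And>x. P x = x \<longleftrightarrow> (\<forall>Q\<in>S. Q x = x)"
proof -
  obtain P where P: "is_proj P" and PS: "\<And>x. P x = x \<longleftrightarrow> (\<forall>Q\<in>S. Q x = x)"
    using proj_exists_INT[of S "\<lambda>Q. Q"] S projections_is_proj by (metis subset_iff)
  have inv: "P (U x) = U x" if "U \<in> commutant R" "P x = x" for U x
  proof -
    have "Q (U x) = U x" if "Q \<in> S" for Q
    proof -
      have "Q \<in> R" using S that by (auto simp: projections_def)
      then have "Q (U x) = U (Q x)" using commutant_commute[OF \<open>U \<in> commutant R\<close>] by simp
      also have "Q x = x" using \<open>P x = x\<close> PS \<open>Q \<in> S\<close> by simp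
      finally show ?thesis .
    qed
    then show ?thesis using PS by simp
  qed
  have "P \<in> R"
  proof (rule von_neumann_memI[OF R])
    show "bounded_op P" using P by (simp add: is_proj_def)
    show "U (P x) = P (U x)" if U: "U \<in> commutant R" for U x
      by (rule proj_commute_invariant[OF P commutant_bounded_op[OF U] inv[OF U] inv[OF commutant_adj[OF R U]]])
  qed
  then show thesis using that P PS by (auto simp: projections_def)
qed

lemma proj_inf_mem:
  assumes R: "von_neumann_algebra R" and P: "P \<in> projections R" and Q: "Q \<in> projections R"
  shows proj_inf_in: "proj_inf R P Q \<in> projections R"
    and proj_inf_fixed: "proj_inf R P Q x = x \<longleftrightarrow> P x = x \<and> Q x = x"
proof -
  obtain Z where Z: "Z \<in> projections R" "\<And>x. Z x = x \<longleftrightarrow> P x = x \<and> Q x = x"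
    using projections_INT[OF R, of "{P, Q}"] P Q by auto
  note ip = projections_is_proj[of _ R]
  have le: "proj_le Z P" "proj_le Z Q"
    using Z(2) is_proj_idem[OF ip[OF Z(1)]] by (simp_all add: proj_le_iff ip Z(1) P Q)
  have greatest: "proj_le Z' Z" if "Z' \<in> projections R" "proj_le Z' P" "proj_le Z' Q" for Z'
    using that Z(2) by (simp add: proj_le_iff ip P Q Z(1))
  have "proj_inf R P Q = Z" unfolding proj_inf_def
    using Z(1) le greatest by (intro the_equality) (blast intro: proj_le_antisym ip)+
  then show "proj_inf R P Q \<in> projections R" "proj_inf R P Q x = x \<longleftrightarrow> P x = x \<and> Q x = x"
    using Z by simp_all
qed

lemma proj_le_inf_iff:
  assumes R: "von_neumann_algebra R" and P: "P \<in> projections R" and Q: "Q \<in> projections R"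
    and Z: "Z \<in> projections R"
  shows "proj_le Z (proj_inf R P Q) \<longleftrightarrow> proj_le Z P \<and> proj_le Z Q"
  using proj_inf_in[OF R P Q] proj_inf_fixed[OF R P Q]
  by (auto simp: proj_le_iff projections_is_proj[of _ R] P Q Z)

text \<open>The supremum is obtained as the infimum of the upper bounds in \<open>R\<close>, so its
  membership in \<open>R\<close> comes from the case of intersections.\<close>

lemma proj_Sup_mem:
  assumes R: "von_neumann_algebra R" and S: "S \<subseteq> projections R"
  shows proj_Sup_in: "proj_Sup R S \<in> projections R"
    and proj_Sup_upper: "Q \<in> S \<Longrightarrow> proj_le Q (proj_Sup R S)"
    and proj_Sup_least: "P \<in> projections R \<Longrightarrow> (\<And>Q. Q \<in> S \<Longrightarrow> proj_le Q P) \<Longrightarrow> proj_le (proj_Sup R S) P"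
proof -
  define W where "W = {P \<in> projections R. \<forall>Q\<in>S. proj_le Q P}"
  note ip = projections_is_proj[of _ R]
  obtain Z where Z: "Z \<in> projections R" "\<And>x. Z x = x \<longleftrightarrow> (\<forall>Q\<in>W. Q x = x)"
    using projections_INT[OF R, of W] by (auto simp: W_def)
  have up: "proj_le Q Z" if Q: "Q \<in> S" for Q
  proof -
    have pQ: "Q \<in> projections R" using Q S by blast
    have "P (Q x) = Q x" if "P \<in> W" for P x
      using that Q pQ proj_le_iff[OF ip ip] by (auto simp: W_def)
    then show ?thesis using Z by (simp add: proj_le_iff ip pQ)
  qed
  have least: "proj_le Z P" if "P \<in> projections R" "\<forall>Q\<in>S. proj_le Q P" for P
  proof -
    have "P \<in> W" using that by (simp add: W_def)
    then show ?thesis using Z is_proj_idem[OF ip[OF Z(1)]] that(1) by (simp add: proj_le_iff ip)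
  qed
  have eq: "proj_Sup R S = Z" unfolding proj_Sup_def
    using Z(1) up least by (intro the_equality) (blast intro: proj_le_antisym ip)+
  show "proj_Sup R S \<in> projections R" "Q \<in> S \<Longrightarrow> proj_le Q (proj_Sup R S)"
    "P \<in> projections R \<Longrightarrow> (\<And>Q. Q \<in> S \<Longrightarrow> proj_le Q P) \<Longrightarrow> proj_le (proj_Sup R S) P"
    using Z(1) up least by (auto simp: eq)
qed

lemma zero_in_projections: "von_neumann_algebra R \<Longrightarrow> (\<lambda>x. 0) \<in> projections R"
  using is_proj_zero
  by (auto simp: projections_def is_proj_def linear_simps[OF bounded_op_linear[OF commutant_bounded_op]]
      intro!: von_neumann_memI)

lemma id_in_projections: "von_neumann_algebra R \<Longrightarrow> id \<in> projections R"
  by (simp add: projections_def is_proj_id von_neumann_algebra_def)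

lemma proj_le_id: "proj_le P id"
  by (simp add: proj_le_def)

lemma proj_le_zeroD: "is_proj P \<Longrightarrow> proj_le P (\<lambda>x. 0) \<Longrightarrow> P = (\<lambda>x. 0)"
  by (simp add: proj_le_iff is_proj_zero fun_eq_iff)

lemma projections_diff:
  assumes R: "von_neumann_algebra R" and P: "P \<in> projections R" and Q: "Q \<in> projections R"
    and le: "proj_le P Q"
  shows "(\<lambda>x. Q x - P x) \<in> projections R"
proof -
  have p: "is_proj (\<lambda>x. Q x - P x)"
    using is_proj_diff[OF _ _ le] projections_is_proj P Q by blast
  moreover have "(\<lambda>x. Q x - P x) \<in> R"
  proof (rule von_neumann_memI[OF R])
    show "bounded_op (\<lambda>x. Q x - P x)" using p by (simp add: is_proj_def)
    fix U x assume U: "U \<in> commutant R"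
    show "U (Q x - P x) = Q (U x) - P (U x)"
      using P Q commutant_commute[OF U]
      by (simp add: projections_def linear_simps[OF bounded_op_linear[OF commutant_bounded_op[OF U]]])
  qed
  ultimately show ?thesis by (simp add: projections_def)
qed

section \<open>Quasipoints\<close>

lemma quasipoint_base: "B \<in> quasipoints R \<Longrightarrow> filter_base R B"
  by (simp add: quasipoints_def)

lemma quasipoint_maximal: "B \<in> quasipoints R \<Longrightarrow> filter_base R B' \<Longrightarrow> B \<subseteq> B' \<Longrightarrow> B' = B"
  by (simp add: quasipoints_def)

lemma quasipoint_projections: "B \<in> quasipoints R \<Longrightarrow> P \<in> B \<Longrightarrow> P \<in> projections R"
  using quasipoint_base[of B R] by (auto simp: filter_base_def)

lemma quasipoint_nonzero: "B \<in> quasipoints R \<Longrightarrow> (\<lambda>x. 0) \<notin> B"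
  using quasipoint_base[of B R] by (auto simp: filter_base_def)

lemma quasipoint_meet:
  assumes "B \<in> quasipoints R" "P \<in> B" "Q \<in> B"
  obtains Z where "Z \<in> B" "proj_le Z (proj_inf R P Q)"
  using quasipoint_base[OF assms(1)] assms(2,3) unfolding filter_base_def by blast

text \<open>The upward closure of \<open>B\<close> is again a filter base, so maximality forces it
  to be \<open>B\<close>.\<close>

lemma quasipoint_upward:
  assumes R: "von_neumann_algebra R" and B: "B \<in> quasipoints R" and P: "P \<in> B"
    and Q: "Q \<in> projections R" and le: "proj_le P Q"
  shows "Q \<in> B"
proof -
  define B' where "B' = {Q \<in> projections R. \<exists>P\<in>B. proj_le P Q}"
  note ip = projections_is_proj[of _ R] and qp = quasipoint_projections[OF B]
  have "filter_base R B'" unfolding filter_base_def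
  proof (intro conjI ballI)
    show "(\<lambda>x. 0) \<notin> B'"
      using quasipoint_nonzero[OF B] proj_le_zeroD ip qp by (fastforce simp: B'_def)
    fix P1 P2 assume 12: "P1 \<in> B'" "P2 \<in> B'"
    then obtain Q1 Q2 where q: "Q1 \<in> B" "Q2 \<in> B" "proj_le Q1 P1" "proj_le Q2 P2"
      by (auto simp: B'_def)
    obtain Z where Z: "Z \<in> B" "proj_le Z (proj_inf R Q1 Q2)"
      using quasipoint_meet[OF B q(1,2)] by blast
    have "proj_le Z Q1" "proj_le Z Q2"
      using Z proj_le_inf_iff[OF R qp[OF q(1)] qp[OF q(2)] qp[OF Z(1)]] by auto
    then have "proj_le Z P1" "proj_le Z P2" using q proj_le_trans by blast+
    then have "proj_le Z (proj_inf R P1 P2)"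
      using proj_le_inf_iff[OF R _ _ qp[OF Z(1)]] 12 by (simp add: B'_def)
    moreover have "Z \<in> B'" using Z(1) qp proj_le_refl ip by (auto simp: B'_def)
    ultimately show "\<exists>Z\<in>B'. proj_le Z (proj_inf R P1 P2)" by blast
  qed (auto simp: B'_def)
  moreover have "B \<subseteq> B'" using qp proj_le_refl ip by (auto simp: B'_def)
  ultimately have "B' = B" by (rule quasipoint_maximal[OF B])
  then show ?thesis using P Q le by (auto simp: B'_def)
qed

lemma quasipoint_inf:
  assumes R: "von_neumann_algebra R" and B: "B \<in> quasipoints R" and PQ: "P \<in> B" "Q \<in> B"
  shows "proj_inf R P Q \<in> B"
proof -
  obtain Z where "Z \<in> B" "proj_le Z (proj_inf R P Q)"
    using quasipoint_meet[OF B PQ] by blast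
  moreover have "proj_inf R P Q \<in> projections R"
    using PQ by (intro proj_inf_in R quasipoint_projections[OF B])
  ultimately show ?thesis using quasipoint_upward[OF R B] by blast
qed

text \<open>Zorn's lemma on the filter bases containing \<open>P\<close>, starting from the
  singleton; \<open>P\<close> must be nonzero for the singleton to qualify.\<close>

lemma quasipoint_exists:
  assumes R: "von_neumann_algebra R" and P: "P \<in> nonzero_projections R"
  obtains B where "B \<in> quasipoints R" "P \<in> B"
proof -
  have pP: "P \<in> projections R" "P \<noteq> (\<lambda>x. 0)" using P by (auto simp: nonzero_projections_def)
  define \<A> where "\<A> = {B. filter_base R B \<and> P \<in> B}"
  have "filter_base R {P}"
    using pP proj_le_inf_iff[OF R pP(1) pP(1) pP(1)] proj_le_refl projections_is_proj
    by (auto simp: filter_base_def)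
  then have ne: "\<A> \<noteq> {}" by (auto simp: \<A>_def)
  have "\<exists>M\<in>\<A>. \<forall>X\<in>\<A>. M \<subseteq> X \<longrightarrow> X = M"
  proof (rule subset_Zorn_nonempty[OF ne])
    fix C assume C: "C \<noteq> {}" "subset.chain \<A> C"
    then have fb: "filter_base R X" "P \<in> X" if "X \<in> C" for X
      using that by (auto simp: subset.chain_def \<A>_def)
    have "\<exists>Z\<in>\<Union>C. proj_le Z (proj_inf R P1 P2)" if "P1 \<in> \<Union>C" "P2 \<in> \<Union>C" for P1 P2
    proof -
      obtain X Y where XY: "X \<in> C" "Y \<in> C" "P1 \<in> X" "P2 \<in> Y"
        using \<open>P1 \<in> \<Union>C\<close> \<open>P2 \<in> \<Union>C\<close> by blast
      then have "X \<subseteq> Y \<or> Y \<subseteq> X" using C(2) by (auto simp: subset_chain_def)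
      then obtain W where "W \<in> C" "P1 \<in> W" "P2 \<in> W" using XY by blast
      then show ?thesis using fb(1)[of W] unfolding filter_base_def by blast
    qed
    moreover have "\<Union>C \<subseteq> projections R" "(\<lambda>x. 0) \<notin> \<Union>C"
      using fb(1) unfolding filter_base_def by blast+
    moreover have "P \<in> \<Union>C" using fb(2) C(1) by blast
    ultimately show "\<Union>C \<in> \<A>" unfolding \<A>_def filter_base_def by blast
  qed
  then obtain M where M: "filter_base R M" "P \<in> M" "\<And>X. filter_base R X \<Longrightarrow> P \<in> X \<Longrightarrow> M \<subseteq> X \<Longrightarrow> X = M"
    by (auto simp: \<A>_def)
  then have "M \<in> quasipoints R" by (auto simp: quasipoints_def)
  then show thesis using that M(2) by blast
qed

text \<open>In the zero space the only quasipoint is empty. A nonzero vector excludes this, because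
  the empty family is then not maximal.\<close>

lemma quasipoint_id:
  assumes R: "von_neumann_algebra R" and nz: "\<exists>x::'a::chilbert_space. x \<noteq> 0"
    and B: "B \<in> quasipoints (R :: ('a \<Rightarrow> 'a) set)"
  shows "id \<in> B"
proof (cases "B = {}")
  case True
  have "id \<in> nonzero_projections R"
    using nz id_in_projections[OF R] by (auto simp: nonzero_projections_def fun_eq_iff)
  then obtain B' where "B' \<in> quasipoints R" "id \<in> B'" using quasipoint_exists[OF R] by blast
  then show ?thesis using quasipoint_maximal[OF B quasipoint_base[of B']] True by blast
next
  case False
  then show ?thesis using quasipoint_upward[OF R B _ id_in_projections[OF R] proj_le_id] by blast
qed

text \<open>The topology is given by generators; they form a base at \<open>B\<close> because
  \<open>B\<close> is closed under meets.\<close>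

lemma quasipoint_nhd:
  assumes R: "von_neumann_algebra R"
    and W: "openin (quasipoint_topology R) W" and B: "B \<in> quasipoints R" "B \<in> W"
  obtains P where "P \<in> B" "quasipoints_at R P \<subseteq> W"
proof -
  have "generate_topology_on {quasipoints_at R P | P. P \<in> projections R} W"
    using W by (simp add: quasipoint_topology_def openin_topology_generated_by_iff)
  then have "\<exists>P\<in>B. quasipoints_at R P \<subseteq> W" using B(2)
  proof induction
    case (Int W1 W2)
    then obtain P Q where PQ: "P \<in> B" "Q \<in> B" "quasipoints_at R P \<subseteq> W1" "quasipoints_at R Q \<subseteq> W2"
      by blast
    note p = quasipoint_projections[OF B(1) PQ(1)] quasipoint_projections[OF B(1) PQ(2)]
    have i: "proj_inf R P Q \<in> projections R" by (rule proj_inf_in[OF R p])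
    have "proj_le (proj_inf R P Q) P" "proj_le (proj_inf R P Q) Q"
      using proj_le_inf_iff[OF R p i] proj_le_refl[OF projections_is_proj[OF i]] by auto
    then have "quasipoints_at R (proj_inf R P Q) \<subseteq> quasipoints_at R P \<inter> quasipoints_at R Q"
      using quasipoint_upward[OF R] p by (auto simp: quasipoints_at_def)
    then show ?case using PQ quasipoint_inf[OF R B(1) PQ(1,2)] by blast
  next
    case (UN K)
    then show ?case by blast
  next
    case (Basis W)
    then show ?case by (auto simp: quasipoints_at_def)
  qed simp
  then show thesis using that by blast
qed

section \<open>Bounded functions on the space of quasipoints\<close>

locale bounded_quasipoint_fun =
  fixes R :: "('a::chilbert_space \<Rightarrow> 'a) set" and f :: "('a \<Rightarrow> 'a) set \<Rightarrow> real"
  assumes nz: "\<exists>x::'a. x \<noteq> 0" and R: "von_neumann_algebra R"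
    and bdd: "bounded (f ` quasipoints R)"
begin

abbreviation r where "r \<equiv> r_fun R f"

lemma nonzero_in: "P \<in> nonzero_projections R \<Longrightarrow> P \<in> projections R"
  by (simp add: nonzero_projections_def)

lemma bdd_quasipoints_at: "bdd_above (f ` quasipoints_at R P)"
  using bounded_imp_bdd_above[OF bdd] by (rule bdd_above_mono) (auto simp: quasipoints_at_def)

lemma le_r: "B \<in> quasipoints R \<Longrightarrow> P \<in> B \<Longrightarrow> f B \<le> r P"
  unfolding r_fun_def by (rule cSUP_upper[OF _ bdd_quasipoints_at]) (simp add: quasipoints_at_def)

text \<open>A nonzero \<open>P\<close> lies in some quasipoint, so the supremum is over a nonempty
  set.\<close>

lemma r_le:
  assumes "P \<in> nonzero_projections R" "\<And>B. B \<in> quasipoints R \<Longrightarrow> P \<in> B \<Longrightarrow> f B \<le> c"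
  shows "r P \<le> c"
  unfolding r_fun_def using quasipoint_exists[OF R assms(1)] assms(2)
  by (intro cSUP_least) (auto simp: quasipoints_at_def)

lemma r_mono:
  assumes "P \<in> nonzero_projections R" "Q \<in> projections R" "proj_le P Q"
  shows "r P \<le> r Q"
  using quasipoint_upward[OF R _ _ assms(2,3)] le_r by (intro r_le[OF assms(1)]) blast

lemma nonzero_mono:
  assumes "P \<in> nonzero_projections R" "Q \<in> projections R" "proj_le P Q"
  shows "Q \<in> nonzero_projections R"
  using assms proj_le_zeroD[of P] projections_is_proj by (auto simp: nonzero_projections_def)

lemma f_bound:
  obtains K where "K > 0" "\<And>B. B \<in> quasipoints R \<Longrightarrow> \<bar>f B\<bar> \<le> K"
proof -
  obtain K where "K > 0" "\<forall>y\<in>f ` quasipoints R. norm y \<le> K" using bdd unfolding bounded_pos by blast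
  then show thesis by (intro that) auto
qed

lemma observable_imp_completely_increasing:
  assumes A: "A \<in> self_adjoint_part R" and fA: "\<And>B. B \<in> quasipoints R \<Longrightarrow> f B = observable_fun A B"
  shows "completely_increasing R r"
proof -
  have AR: "A \<in> R" and symA: "symmetric_op A"
    using A von_neumann_bounded_op[OF R] by (auto simp: self_adjoint_part_def symmetric_op_iff_adj)
  obtain E where E: "spectral_family A E" using spectral_family_exists[OF symA] by blast
  obtain a b where "proj_resolution E a b" by (rule spectral_family_resolution[OF E]) blast
  interpret proj_resolution E a b by fact
  have ER: "E l \<in> projections R" for l
  proof -
    have "E l \<in> R"
    proof (rule von_neumann_memI[OF R])
      show "bounded_op (E l)" using proj by (simp add: is_proj_def)
      show "U (E l x) = E l (U x)" if U: "U \<in> commutant R" for U x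
        by (rule spectral_family_commute[OF symA E commutant_bounded_op[OF U] commutant_commute[OF U AR]])
    qed
    then show ?thesis using proj by (simp add: projections_def)
  qed
  have fE: "f B = Inf {l. E l \<in> B}" if "B \<in> quasipoints R" for B
    using fA[OF that] by (simp add: observable_fun_def spec_fam_eq[OF symA E])
  \<comment> \<open>Zero belongs to no quasipoint; hence the set whose infimum defines
    \<open>f B\<close> is bounded below.\<close>
  have below: "l > a" if "B \<in> quasipoints R" "E l \<in> B" for B l
    using quasipoint_nonzero[OF that(1)] that(2) low[of l] by (metis not_less)
  have r_le_E: "r P \<le> l" if P: "P \<in> nonzero_projections R" and le: "proj_le P (E l)" for P l
  proof (rule r_le[OF P])
    fix B assume B: "B \<in> quasipoints R" "P \<in> B"
    then have "E l \<in> B" using quasipoint_upward[OF R _ _ ER le] by blast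
    moreover have "bdd_below {l. E l \<in> B}" using below[OF B(1)] by (intro bdd_belowI[of _ a]) (simp add: less_imp_le)
    ultimately show "f B \<le> l" unfolding fE[OF B(1)] by (intro cInf_lower) auto
  qed
  have le_E: "proj_le P (E l)" if P: "P \<in> nonzero_projections R" and less: "r P < l" for P l
  proof (rule ccontr)
    assume nle: "\<not> proj_le P (E l)"
    note pP = nonzero_in[OF P]
    define Z where "Z = proj_inf R P (E l)"
    have Z: "Z \<in> projections R" unfolding Z_def by (rule proj_inf_in[OF R pP ER])
    have fixZ: "Z x = x \<longleftrightarrow> P x = x \<and> E l x = x" for x unfolding Z_def by (rule proj_inf_fixed[OF R pP ER])
    have ZP: "proj_le Z P" "proj_le Z (E l)"
      using proj_le_inf_iff[OF R pP ER[of l] Z] proj_le_refl[OF projections_is_proj[OF Z]] by (simp_all add: Z_def)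
    define Q where "Q x = P x - Z x" for x
    have Q: "Q \<in> projections R" unfolding Q_def[abs_def] by (rule projections_diff[OF R Z pP ZP(1)])
    have "Q \<noteq> (\<lambda>x. 0)"
    proof
      assume "Q = (\<lambda>x. 0)"
      then have "P = Z" by (simp add: Q_def fun_eq_iff)
      then show False using nle ZP by simp
    qed
    then have nzQ: "Q \<in> nonzero_projections R" using Q by (simp add: nonzero_projections_def)
    then obtain B where B: "B \<in> quasipoints R" "Q \<in> B" using quasipoint_exists[OF R] by blast
    have PQ: "P (Q x) = Q x" "Z (Q x) = 0" for x
      using proj_le_apply[OF ZP(1)] projections_is_proj[OF Z] projections_is_proj[OF pP]
      by (simp_all add: Q_def linear_simps[OF is_proj_linear] is_proj_idem)
    then have "P \<in> B" using quasipoint_upward[OF R B pP] proj_le_iff projections_is_proj Q pP by blast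
    then have "f B \<le> r P" by (rule le_r[OF B(1)])
    moreover have "l \<le> f B" unfolding fE[OF B(1)]
    proof (rule cInf_greatest)
      show "{l. E l \<in> B} \<noteq> {}" using quasipoint_id[OF R nz B(1)] high[of b] by (metis empty_Collect_eq order_refl)
      fix m assume "m \<in> {l. E l \<in> B}"
      then have m: "E m \<in> B" by simp
      show "l \<le> m"
      proof (rule ccontr)
        assume "\<not> l \<le> m"
        \<comment> \<open>With \<open>Q\<close> and \<open>E l\<close> both in \<open>B\<close>,
          some member of \<open>B\<close> lies below both. It is then below \<open>P\<close> and
          \<open>E l\<close>, hence below \<open>Z\<close>, yet \<open>Z\<close> annihilates the
          range of \<open>Q\<close>.\<close>
        then have "E l \<in> B" using quasipoint_upward[OF R B(1) m ER mono] by simp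
        then obtain W where W: "W \<in> B" "proj_le W (proj_inf R Q (E l))"
          using quasipoint_meet[OF B] by blast
        have pW: "W \<in> projections R" by (rule quasipoint_projections[OF B(1) W(1)])
        have "Q (W x) = W x" "E l (W x) = W x" for x
          using W(2) proj_le_inf_iff[OF R Q ER pW] by (auto simp: proj_le_iff projections_is_proj[of _ R] pW Q ER)
        then have "W x = 0" for x using fixZ[of "W x"] PQ[of "W x"] by metis
        then have "W = (\<lambda>x. 0)" by blast
        then show False using W(1) quasipoint_nonzero[OF B(1)] by simp
      qed
    qed
    ultimately show False using less by simp
  qed
  show ?thesis unfolding completely_increasing_def
  proof (intro allI impI)
    fix S assume "S \<noteq> {} \<and> S \<subseteq> nonzero_projections R"
    then have ne: "S \<noteq> {}" and S: "S \<subseteq> nonzero_projections R" by auto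
    have Sp: "S \<subseteq> projections R" using S nonzero_in by blast
    define J where "J = proj_Sup R S"
    have J: "J \<in> projections R" unfolding J_def by (rule proj_Sup_in[OF R Sp])
    have up: "proj_le P J" if "P \<in> S" for P unfolding J_def by (rule proj_Sup_upper[OF R Sp that])
    have le: "r P \<le> r J" if "P \<in> S" for P using r_mono[OF _ J up[OF that]] S that by blast
    have nzJ: "J \<in> nonzero_projections R" using ne nonzero_mono[OF _ J up] S by blast
    have bd: "bdd_above (r ` S)" using le by (intro bdd_aboveI2)
    have "r J \<le> Sup (r ` S)"
    proof (rule field_le_epsilon)
      fix e :: real assume e: "e > 0"
      have "proj_le P (E (Sup (r ` S) + e))" if "P \<in> S" for P
        using le_E S that cSUP_upper[OF that bd] e by (meson add_strict_increasing2 le_less_trans less_add_same_cancel1 subsetD)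
      then have "proj_le J (E (Sup (r ` S) + e))" unfolding J_def by (rule proj_Sup_least[OF R Sp ER])
      then show "r J \<le> Sup (r ` S) + e" by (rule r_le_E[OF nzJ])
    qed
    moreover have "Sup (r ` S) \<le> r J" using ne le by (intro cSUP_least)
    ultimately show "r (proj_Sup R S) = Sup (r ` S)" by (simp add: J_def)
  qed
qed

lemma completely_increasing_imp_observable:
  assumes ci: "completely_increasing R r"
    and cont: "continuous_map (quasipoint_topology R) euclideanreal f"
  obtains A where "A \<in> self_adjoint_part R" "\<And>B. B \<in> quasipoints R \<Longrightarrow> f B = observable_fun A B"
proof -
  define S where "S l = {P \<in> nonzero_projections R. r P \<le> l}" for l
  define E where "E l = proj_Sup R (S l)" for l
  have Sp: "S l \<subseteq> projections R" for l using nonzero_in by (auto simp: S_def)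
  have ER: "E l \<in> projections R" for l unfolding E_def by (rule proj_Sup_in[OF R Sp])
  note Ep = projections_is_proj[OF ER]
  have le_E: "proj_le P (E l)" if "P \<in> nonzero_projections R" "r P \<le> l" for P l
    unfolding E_def using that by (intro proj_Sup_upper[OF R Sp]) (simp add: S_def)
  have E_empty: "E l = (\<lambda>x. 0)" if "S l = {}" for l
  proof (rule proj_le_zeroD[OF Ep])
    show "proj_le (E l) (\<lambda>x. 0)"
      unfolding E_def using that by (intro proj_Sup_least[OF R Sp zero_in_projections[OF R]]) simp
  qed
  have rE: "r (E l) \<le> l" if "E l \<noteq> (\<lambda>x. 0)" for l
  proof -
    have ne: "S l \<noteq> {}" using that E_empty by blast
    then have "r (E l) = Sup (r ` S l)"
      using ci unfolding completely_increasing_def E_def by (auto simp: S_def)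
    also have "\<dots> \<le> l" using ne by (intro cSUP_least) (auto simp: S_def)
    finally show ?thesis .
  qed
  have r_le_E: "r P \<le> l" if P: "P \<in> nonzero_projections R" and le: "proj_le P (E l)" for P l
  proof -
    have "E l \<in> nonzero_projections R" by (rule nonzero_mono[OF P ER le])
    then show ?thesis using rE[of l] r_mono[OF P ER le] by (simp add: nonzero_projections_def)
  qed
  obtain K where K: "K > 0" "\<And>B. B \<in> quasipoints R \<Longrightarrow> \<bar>f B\<bar> \<le> K" by (rule f_bound) blast
  have mono: "proj_le (E l) (E m)" if "l \<le> m" for l m
    unfolding E_def[of l] using that by (intro proj_Sup_least[OF R Sp ER] le_E) (auto simp: S_def)
  interpret proj_resolution E "- K - 1" K
  proof
    show "- K - 1 < K" using K by simp
    fix l :: real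
    show "E l = (\<lambda>x. 0)" if l: "l \<le> - K - 1"
    proof (rule E_empty, rule ccontr)
      assume "S l \<noteq> {}"
      then obtain P where P: "P \<in> nonzero_projections R" "r P \<le> l" by (auto simp: S_def)
      obtain B where B: "B \<in> quasipoints R" "P \<in> B" using quasipoint_exists[OF R P(1)] by blast
      show False using le_r[OF B] P(2) K(2)[OF B(1)] l by linarith
    qed
    show "E l = id" if l: "K \<le> l"
    proof (rule proj_le_antisym[OF proj_le_id _ Ep is_proj_id])
      have "id \<in> nonzero_projections R"
        using nz id_in_projections[OF R] by (auto simp: nonzero_projections_def fun_eq_iff)
      moreover from this have "r id \<le> l" using K(2) l by (intro r_le) fastforce+
      ultimately show "proj_le id (E l)" by (rule le_E)
    qed
  qed (use Ep mono in auto)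
  have right: "((\<lambda>m. E m x) \<longlongrightarrow> E l x) (at_right l)" for l x
  proof (rule proj_tendsto_inf[OF Ep mono Ep])
    obtain P where P: "P \<in> projections R" and PE: "\<And>x. P x = x \<longleftrightarrow> (\<forall>Q\<in>E ` {l<..}. Q x = x)"
      using projections_INT[OF R, of "E ` {l<..}"] ER by blast
    have PEm: "proj_le P (E m)" if "m > l" for m
      using that PE is_proj_idem[OF projections_is_proj[OF P]] by (simp add: proj_le_iff projections_is_proj[OF P] Ep)
    have "proj_le P (E l)"
    proof (cases "P = (\<lambda>x. 0)")
      case True
      then show ?thesis by (simp add: proj_le_iff is_proj_zero Ep linear_simps[OF is_proj_linear[OF Ep]])
    next
      case False
      then have nzP: "P \<in> nonzero_projections R" using P by (simp add: nonzero_projections_def)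
      have "r P \<le> l" using r_le_E[OF nzP PEm] by (rule dense_ge)
      then show ?thesis by (rule le_E[OF nzP])
    qed
    then have PEl: "E l (P x) = P x" for x by (simp add: proj_le_iff projections_is_proj[OF P] Ep)
    show "E l x = x \<longleftrightarrow> (\<forall>m>l. E m x = x)" for x
    proof
      show "\<forall>m>l. E m x = x" if "E l x = x" using E_E(1)[of l _ x] that by simp
      assume "\<forall>m>l. E m x = x"
      then have "P x = x" using PE by simp
      then show "E l x = x" using PEl[of x] by simp
    qed
  qed
  obtain A where A: "symmetric_op A" and cut: "\<And>l. spectral_cut A 0 (E l) l"
    and commA: "\<And>U x. bounded_linear U \<Longrightarrow> (\<And>l x. U (E l x) = E l (U x)) \<Longrightarrow> U (A x) = A (U x)"
    using spectral_integral_exists by blast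
  have "A \<in> R"
  proof (rule von_neumann_memI[OF R])
    show "bounded_op A" using A by (simp add: symmetric_op_def)
    fix U x assume U: "U \<in> commutant R"
    show "U (A x) = A (U x)"
      using commutant_commute[OF U] ER
      by (intro commA bounded_op_linear[OF commutant_bounded_op[OF U]]) (simp add: projections_def)
  qed
  then have "A \<in> self_adjoint_part R" using A by (simp add: self_adjoint_part_def symmetric_op_iff_adj)
  moreover have "f B = observable_fun A B" if B: "B \<in> quasipoints R" for B
  proof -
    have "observable_fun A B = Inf {l. E l \<in> B}"
      by (simp add: observable_fun_def spec_fam_eq[OF A spectral_familyI[OF right A cut]])
    also have "\<dots> = f B"
    proof (rule antisym)
      have lower: "f B \<le> l" if "E l \<in> B" for l
      proof -
        have "E l \<noteq> (\<lambda>x. 0)" using that quasipoint_nonzero[OF B] by metis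
        then show ?thesis using rE[of l] le_r[OF B that] by simp
      qed
      show "f B \<le> Inf {l. E l \<in> B}"
      proof (rule cInf_greatest)
        show "{l. E l \<in> B} \<noteq> {}" using quasipoint_id[OF R nz B] high[of K] by (metis empty_Collect_eq order_refl)
      qed (use lower in simp)
      show "Inf {l. E l \<in> B} \<le> f B"
      proof (rule field_le_epsilon)
        fix e :: real assume e: "e > 0"
        let ?W = "{C \<in> topspace (quasipoint_topology R). f C \<in> {..<f B + e}}"
        have "B \<in> topspace (quasipoint_topology R)"
          using quasipoint_id[OF R nz B] B id_in_projections[OF R]
          by (auto simp: quasipoint_topology_def topology_generated_by_topspace quasipoints_at_def)
        then have "B \<in> ?W" using e by simp
        moreover have "openin (quasipoint_topology R) ?W"
          by (rule openin_continuous_map_preimage[OF cont]) simp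
        ultimately obtain P where P: "P \<in> B" "quasipoints_at R P \<subseteq> ?W"
          using quasipoint_nhd[OF R _ B] by blast
        have nzP: "P \<in> nonzero_projections R"
          using quasipoint_projections[OF B P(1)] quasipoint_nonzero[OF B] P(1)
          by (auto simp: nonzero_projections_def)
        have "r P \<le> f B + e" using P(2) by (intro r_le[OF nzP]) (force simp: quasipoints_at_def)
        then have "E (f B + e) \<in> B" using quasipoint_upward[OF R B P(1) ER le_E[OF nzP]] by blast
        then show "Inf {l. E l \<in> B} \<le> f B + e"
          using lower by (intro cInf_lower bdd_belowI[of _ "f B"]) auto
      qed
    qed
    finally show ?thesis by simp
  qed
  ultimately show thesis using that by blast
qed

end

theorem theorem2p27:
  fixes R :: "('a::chilbert_space \<Rightarrow> 'a) set"
    and f :: "('a \<Rightarrow> 'a) set \<Rightarrow> real"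
  assumes "\<exists>x::'a. x \<noteq> 0"
    and "von_neumann_algebra R"
    and "bounded (f ` quasipoints R)"
    and "continuous_map (quasipoint_topology R) euclideanreal f"
  shows "(\<exists>A\<in>self_adjoint_part R. \<forall>B\<in>quasipoints R. f B = observable_fun A B)
         \<longleftrightarrow> completely_increasing R (r_fun R f)"
proof -
  interpret bounded_quasipoint_fun R f by unfold_locales (fact assms)+
  show ?thesis
    using observable_imp_completely_increasing completely_increasing_imp_observable assms(4) by metis
qed

end
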